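(* A countable group $G$ is locally virtually cyclic (every finitely generated subgroup of $G$ is virtually cyclic) if and only if the constant functor $\underline{\mathbb{Z}}$ is a flat right $\mathcal{O}_{\mathcal{VC}}G$-module.
   Context: A group is virtually cyclic if it has a cyclic subgroup of finite index (finite groups are included). For a group $G$, let $\mathcal{VC}$ be the family of virtually cyclic subgroups of $G$. The orbit category $\mathcal{O}_{\mathcal{VC}}G$ has as objects the left coset spaces $G/H$ with $H\in\mathcal{VC}$, and as morphisms all $G$-equivariant maps. A right (resp. left) $\mathcal{O}_{\mathcal{VC}}G$-module is a contravariant (resp. covariant) functor from $\mathcal{O}_{\mathcal{VC}}G$ to abelian groups; morphisms are natural transformations and exactness is objectwise. $\underline{\mathbb{Z}}$ is the constant contravariant functor with value $\mathbb{Z}$. For a right module $M$ and a left module $N$, the categorical tensor product $M\otimes_{\mathcal{O}_{\mathcal{VC}}G}N$ is the quotient of $\bigoplus_{H\in\mathcal{VC}}M(G/H)\otimes_{\mathbb{Z}}N(G/H)$ by the subgroup generated by all $\varphi^*(m)\otimes n-m\otimes\varphi_*(n)$, where $\varphi:G/H\to G/K$ is a morphism, $m\in M(G/K)$ and $n\in N(G/H)$. A right module $M$ is flat if $M\otimes_{\mathcal{O}_{\mathcal{VC}}G}-$ is an exact functor from left $\mathcal{O}_{\mathcal{VC}}G$-modules to abelian groups. *)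

theory Defs
  imports "HOL-Algebra.Algebra" "HOL-Library.Countable_Set"
begin

section \<open>Virtually cyclic groups\<close>

definition virtually_cyclic_group :: "('a, 'b) monoid_scheme \<Rightarrow> bool" where
  "virtually_cyclic_group G \<longleftrightarrow>
     group G \<and> (\<exists>C. subgroup C G \<and> cyclic_group (G\<lparr>carrier := C\<rparr>) \<and> finite (rcosets\<^bsub>G\<^esub> C))"

definition virtually_cyclic_subgroups :: "('a, 'b) monoid_scheme \<Rightarrow> 'a set set" where
  "virtually_cyclic_subgroups G =
     {H. subgroup H G \<and> virtually_cyclic_group (G\<lparr>carrier := H\<rparr>)}"

definition locally_virtually_cyclic :: "('a, 'b) monoid_scheme \<Rightarrow> bool" where
  "locally_virtually_cyclic G \<longleftrightarrow>
     (\<forall>S. finite S \<and> S \<subseteq> carrier G \<longrightarrow> virtually_cyclic_group (subgroup_generated G S))"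

section \<open>The orbit category of a group with respect to a family of subgroups\<close>

text \<open>An object is a left coset space $G/H$, as a set of subsets of the group. A morphism is an
  equivariant map, represented by a function that is \<^const>\<open>undefined\<close> outside its domain, so that
  equal morphisms are equal functions.\<close>

definition orbit_objects :: "('a, 'b) monoid_scheme \<Rightarrow> 'a set set \<Rightarrow> 'a set set set" where
  "orbit_objects G F = (\<lambda>H. lcosets\<^bsub>G\<^esub> H) ` F"

definition orbit_hom ::
  "('a, 'b) monoid_scheme \<Rightarrow> 'a set set \<Rightarrow> 'a set set \<Rightarrow> ('a set \<Rightarrow> 'a set) set" where
  "orbit_hom G U V =
     {\<phi> \<in> U \<rightarrow>\<^sub>E V. \<forall>g\<in>carrier G. \<forall>A\<in>U. \<phi> (g <#\<^bsub>G\<^esub> A) = g <#\<^bsub>G\<^esub> \<phi> A}"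

section \<open>Modules over the orbit category\<close>

text \<open>Abelian groups are commutative groups in the sense of \<^locale>\<open>comm_group\<close>, hence written
  multiplicatively. In both variances, \<open>mact M U V \<phi>\<close> is the homomorphism induced by the morphism
  \<open>\<phi>\<close> from \<open>U\<close> to \<open>V\<close>; it goes from \<open>mval M V\<close> to \<open>mval M U\<close> for right modules and from
  \<open>mval M U\<close> to \<open>mval M V\<close> for left modules.\<close>

record ('a, 'u) orbit_module =
  mval :: "'a set set \<Rightarrow> 'u monoid"
  mact :: "'a set set \<Rightarrow> 'a set set \<Rightarrow> ('a set \<Rightarrow> 'a set) \<Rightarrow> 'u \<Rightarrow> 'u"

definition right_module ::
  "('a, 'b) monoid_scheme \<Rightarrow> 'a set set \<Rightarrow> ('a, 'u) orbit_module \<Rightarrow> bool" where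
  "right_module G F M \<longleftrightarrow>
     (\<forall>U\<in>orbit_objects G F. comm_group (mval M U)) \<and>
     (\<forall>U\<in>orbit_objects G F. \<forall>V\<in>orbit_objects G F. \<forall>\<phi>\<in>orbit_hom G U V.
        mact M U V \<phi> \<in> hom (mval M V) (mval M U)) \<and>
     (\<forall>U\<in>orbit_objects G F. \<forall>m\<in>carrier (mval M U). mact M U U (\<lambda>A\<in>U. A) m = m) \<and>
     (\<forall>U\<in>orbit_objects G F. \<forall>V\<in>orbit_objects G F. \<forall>W\<in>orbit_objects G F.
        \<forall>\<phi>\<in>orbit_hom G U V. \<forall>\<psi>\<in>orbit_hom G V W. \<forall>m\<in>carrier (mval M W).
          mact M U W (compose U \<psi> \<phi>) m = mact M U V \<phi> (mact M V W \<psi> m))"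

definition left_module ::
  "('a, 'b) monoid_scheme \<Rightarrow> 'a set set \<Rightarrow> ('a, 'u) orbit_module \<Rightarrow> bool" where
  "left_module G F N \<longleftrightarrow>
     (\<forall>U\<in>orbit_objects G F. comm_group (mval N U)) \<and>
     (\<forall>U\<in>orbit_objects G F. \<forall>V\<in>orbit_objects G F. \<forall>\<phi>\<in>orbit_hom G U V.
        mact N U V \<phi> \<in> hom (mval N U) (mval N V)) \<and>
     (\<forall>U\<in>orbit_objects G F. \<forall>n\<in>carrier (mval N U). mact N U U (\<lambda>A\<in>U. A) n = n) \<and>
     (\<forall>U\<in>orbit_objects G F. \<forall>V\<in>orbit_objects G F. \<forall>W\<in>orbit_objects G F.
        \<forall>\<phi>\<in>orbit_hom G U V. \<forall>\<psi>\<in>orbit_hom G V W. \<forall>n\<in>carrier (mval N U).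
          mact N U W (compose U \<psi> \<phi>) n = mact N V W \<psi> (mact N U V \<phi> n))"

definition left_module_hom ::
  "('a, 'b) monoid_scheme \<Rightarrow> 'a set set \<Rightarrow> ('a, 'u) orbit_module \<Rightarrow> ('a, 'v) orbit_module
     \<Rightarrow> ('a set set \<Rightarrow> 'u \<Rightarrow> 'v) set" where
  "left_module_hom G F N N' =
     {\<eta>. (\<forall>U\<in>orbit_objects G F. \<eta> U \<in> hom (mval N U) (mval N' U)) \<and>
         (\<forall>U\<in>orbit_objects G F. \<forall>V\<in>orbit_objects G F. \<forall>\<phi>\<in>orbit_hom G U V. \<forall>n\<in>carrier (mval N U).
            \<eta> V (mact N U V \<phi> n) = mact N' U V \<phi> (\<eta> U n))}"

definition constant_Z_module :: "('a, int) orbit_module" where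
  "constant_Z_module = \<lparr>mval = (\<lambda>U. integer_group), mact = (\<lambda>U V \<phi> m. m)\<rparr>"

section \<open>Tensor products\<close>

text \<open>The map from a quotient group to \<open>G' Mod K'\<close> induced by a map \<open>f\<close> into \<open>G'\<close>. Its value at a
  coset is the common class of all \<open>f x\<close> with \<open>x\<close> in that coset.\<close>

definition quotient_map ::
  "('b, 'c) monoid_scheme \<Rightarrow> 'b set \<Rightarrow> ('a \<Rightarrow> 'b) \<Rightarrow> 'a set \<Rightarrow> 'b set" where
  "quotient_map G' K' f C = the_elem ((\<lambda>x. K' #>\<^bsub>G'\<^esub> f x) ` C)"

subsection \<open>Tensor product of abelian groups\<close>

definition bilinear_relations :: "'m monoid \<Rightarrow> 'n monoid \<Rightarrow> ('m \<times> 'n \<Rightarrow>\<^sub>0 int) set" where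
  "bilinear_relations A B =
     {frag_of (a \<otimes>\<^bsub>A\<^esub> a', b) - frag_of (a, b) - frag_of (a', b) | a a' b.
        a \<in> carrier A \<and> a' \<in> carrier A \<and> b \<in> carrier B} \<union>
     {frag_of (a, b \<otimes>\<^bsub>B\<^esub> b') - frag_of (a, b) - frag_of (a, b') | a b b'.
        a \<in> carrier A \<and> b \<in> carrier B \<and> b' \<in> carrier B}"

abbreviation pairs_group :: "'m monoid \<Rightarrow> 'n monoid \<Rightarrow> ('m \<times> 'n \<Rightarrow>\<^sub>0 int) monoid" where
  "pairs_group A B \<equiv> free_Abelian_group (carrier A \<times> carrier B)"

definition bilinear_kernel :: "'m monoid \<Rightarrow> 'n monoid \<Rightarrow> ('m \<times> 'n \<Rightarrow>\<^sub>0 int) set" where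
  "bilinear_kernel A B = generate (pairs_group A B) (bilinear_relations A B)"

definition tensor_group :: "'m monoid \<Rightarrow> 'n monoid \<Rightarrow> ('m \<times> 'n \<Rightarrow>\<^sub>0 int) set monoid" where
  "tensor_group A B = pairs_group A B Mod bilinear_kernel A B"

definition pure_tensor :: "'m monoid \<Rightarrow> 'n monoid \<Rightarrow> 'm \<Rightarrow> 'n \<Rightarrow> ('m \<times> 'n \<Rightarrow>\<^sub>0 int) set" where
  "pure_tensor A B a b = bilinear_kernel A B #>\<^bsub>pairs_group A B\<^esub> frag_of (a, b)"

text \<open>The map $A \otimes h : A \otimes B \to A \otimes B'$.\<close>

definition tensor_group_map ::
  "'m monoid \<Rightarrow> 'n monoid \<Rightarrow> ('l \<Rightarrow> 'n) \<Rightarrow> ('m \<times> 'l \<Rightarrow>\<^sub>0 int) set \<Rightarrow> ('m \<times> 'n \<Rightarrow>\<^sub>0 int) set" where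
  "tensor_group_map A B' h =
     quotient_map (pairs_group A B') (bilinear_kernel A B')
       (frag_extend (\<lambda>(a, b). frag_of (a, h b)))"

subsection \<open>Tensor product of a right and a left module over the orbit category\<close>

text \<open>The direct sum runs over the objects $G/H$ instead of over the subgroups \<open>H\<close>; this is the same
  index set, as \<open>H\<close> is the coset in $G/H$ that contains the unit.\<close>

definition tensor_sum ::
  "('a, 'b) monoid_scheme \<Rightarrow> 'a set set \<Rightarrow> ('a, 'm) orbit_module \<Rightarrow> ('a, 'n) orbit_module
     \<Rightarrow> ('a set set \<Rightarrow> ('m \<times> 'n \<Rightarrow>\<^sub>0 int) set) monoid" where
  "tensor_sum G F M N = sum_group (orbit_objects G F) (\<lambda>U. tensor_group (mval M U) (mval N U))"

text \<open>The element $m \otimes n$ of the summand at \<open>U\<close>.\<close>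

definition summand_tensor ::
  "('a, 'b) monoid_scheme \<Rightarrow> 'a set set \<Rightarrow> ('a, 'm) orbit_module \<Rightarrow> ('a, 'n) orbit_module
     \<Rightarrow> 'a set set \<Rightarrow> 'm \<Rightarrow> 'n \<Rightarrow> ('a set set \<Rightarrow> ('m \<times> 'n \<Rightarrow>\<^sub>0 int) set)" where
  "summand_tensor G F M N U m n =
     (\<lambda>V\<in>orbit_objects G F.
        if V = U then pure_tensor (mval M U) (mval N U) m n
        else \<one>\<^bsub>tensor_group (mval M V) (mval N V)\<^esub>)"

definition balancing_relations ::
  "('a, 'b) monoid_scheme \<Rightarrow> 'a set set \<Rightarrow> ('a, 'm) orbit_module \<Rightarrow> ('a, 'n) orbit_module
     \<Rightarrow> ('a set set \<Rightarrow> ('m \<times> 'n \<Rightarrow>\<^sub>0 int) set) set" where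
  "balancing_relations G F M N =
     {summand_tensor G F M N U (mact M U V \<phi> m) n
        \<otimes>\<^bsub>tensor_sum G F M N\<^esub>
        inv\<^bsub>tensor_sum G F M N\<^esub> summand_tensor G F M N V m (mact N U V \<phi> n) | U V \<phi> m n.
        U \<in> orbit_objects G F \<and> V \<in> orbit_objects G F \<and> \<phi> \<in> orbit_hom G U V \<and>
        m \<in> carrier (mval M V) \<and> n \<in> carrier (mval N U)}"

definition balancing_kernel ::
  "('a, 'b) monoid_scheme \<Rightarrow> 'a set set \<Rightarrow> ('a, 'm) orbit_module \<Rightarrow> ('a, 'n) orbit_module
     \<Rightarrow> ('a set set \<Rightarrow> ('m \<times> 'n \<Rightarrow>\<^sub>0 int) set) set" where
  "balancing_kernel G F M N = generate (tensor_sum G F M N) (balancing_relations G F M N)"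

definition module_tensor ::
  "('a, 'b) monoid_scheme \<Rightarrow> 'a set set \<Rightarrow> ('a, 'm) orbit_module \<Rightarrow> ('a, 'n) orbit_module
     \<Rightarrow> ('a set set \<Rightarrow> ('m \<times> 'n \<Rightarrow>\<^sub>0 int) set) set monoid" where
  "module_tensor G F M N = tensor_sum G F M N Mod balancing_kernel G F M N"

text \<open>The map $M \otimes \eta : M \otimes N \to M \otimes N'$.\<close>

definition module_tensor_map ::
  "('a, 'b) monoid_scheme \<Rightarrow> 'a set set \<Rightarrow> ('a, 'm) orbit_module \<Rightarrow> ('a, 'n) orbit_module
     \<Rightarrow> ('a set set \<Rightarrow> 'l \<Rightarrow> 'n)
     \<Rightarrow> ('a set set \<Rightarrow> ('m \<times> 'l \<Rightarrow>\<^sub>0 int) set) set \<Rightarrow> ('a set set \<Rightarrow> ('m \<times> 'n \<Rightarrow>\<^sub>0 int) set) set" where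
  "module_tensor_map G F M N' \<eta> =
     quotient_map (tensor_sum G F M N') (balancing_kernel G F M N')
       (\<lambda>s. \<lambda>U\<in>orbit_objects G F. tensor_group_map (mval M U) (mval N' U) (\<eta> U) (s U))"

section \<open>Flatness\<close>

text \<open>\<open>module_short_exact G F N1 N2 N3 \<eta> \<theta>\<close> says that
  $0 \to N_1 \stackrel{\eta}{\to} N_2 \stackrel{\theta}{\to} N_3 \to 0$ is exact.
  The library's \<^const>\<open>short_exact_sequence\<close> lists groups and maps from right to left.\<close>

definition module_short_exact ::
  "('a, 'b) monoid_scheme \<Rightarrow> 'a set set
     \<Rightarrow> ('a, 'u) orbit_module \<Rightarrow> ('a, 'u) orbit_module \<Rightarrow> ('a, 'u) orbit_module
     \<Rightarrow> ('a set set \<Rightarrow> 'u \<Rightarrow> 'u) \<Rightarrow> ('a set set \<Rightarrow> 'u \<Rightarrow> 'u) \<Rightarrow> bool" where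
  "module_short_exact G F N1 N2 N3 \<eta> \<theta> \<longleftrightarrow>
     left_module G F N1 \<and> left_module G F N2 \<and> left_module G F N3 \<and>
     \<eta> \<in> left_module_hom G F N1 N2 \<and> \<theta> \<in> left_module_hom G F N2 N3 \<and>
     (\<forall>U\<in>orbit_objects G F. short_exact_sequence (mval N3 U) (mval N2 U) (mval N1 U) (\<theta> U) (\<eta> U))"

text \<open>HOL cannot quantify over types inside a definition, so the type \<open>'u\<close> in which the test modules
  take their values is an explicit parameter.\<close>

definition flat_right_module ::
  "'u itself \<Rightarrow> ('a, 'b) monoid_scheme \<Rightarrow> 'a set set \<Rightarrow> ('a, 'm) orbit_module \<Rightarrow> bool" where
  "flat_right_module _ G F M \<longleftrightarrow>
     right_module G F M \<and>
     (\<forall>(N1 :: ('a, 'u) orbit_module) N2 N3 \<eta> \<theta>.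
        module_short_exact G F N1 N2 N3 \<eta> \<theta> \<longrightarrow>
        short_exact_sequence (module_tensor G F M N3) (module_tensor G F M N2) (module_tensor G F M N1)
          (module_tensor_map G F M N3 \<theta>) (module_tensor_map G F M N2 \<eta>))"

end

theory Submission
  imports Defs
begin

text \<open>The tensor product \<open>Z \<otimes> N\<close> with the constant module is the colimit of \<open>N\<close> over the orbit category.

  If \<open>G\<close> is locally virtually cyclic, then \<open>H\<close>, \<open>K\<close> and \<open>a \<in> G\<close> always lie in a common virtually
  cyclic subgroup \<open>L\<close>, since virtually cyclic groups are finitely generated. A morphism
  \<open>G/H \<rightarrow> G/K\<close>, \<open>H \<mapsto> aK\<close>, becomes the canonical projection after composing with \<open>G/K \<rightarrow> G/L\<close> as soon as
  \<open>a \<in> L\<close>, so the colimit is a directed colimit along projections, and hence exact.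

  Conversely, let \<open>S \<subseteq> G\<close> be finite and let \<open>P\<close> be the left module sending an orbit \<open>U\<close> to the free abelian
  group on \<open>U\<close>. The endomorphism \<open>D = (\<Sum>s\<in>S. s\<inverse> - 1)\<close> of \<open>P\<close> induces zero on the colimit of \<open>P\<close>, which is
  non-zero by augmentation. By flatness \<open>D\<close> is therefore not injective, and the maximum principle yields
  a finite non-empty subset of some \<open>G/K\<close> that is closed under \<open>S\<close>. So the group generated by \<open>S\<close> has a
  finite orbit on \<open>G/K\<close> with \<open>K\<close> virtually cyclic, and is itself virtually cyclic. Countability of
  \<open>G\<close> is what allows \<open>P\<close> and the cokernel of \<open>D\<close> to be encoded in the infinite type of test values.\<close>

section \<open>Quotients of abelian groups\<close>

text \<open>About a tensor product given by generators and relations one must know how its elements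
  look and which of them vanish. Generation lemmas answer the first question. Vanishing is detected
  by a homomorphism to a test group, supplied by the universal property: a reduced product in one
  direction, the integers with the augmentation in the other.

  The reason why \<open>D\<close> acts as zero on the class of the point 1 of G/1 is that right
  multiplication by \<open>a\<close> is an endomorphism of the orbit G/1. In the colimit all points
  of G/1 therefore have the same class, and each difference \<open>[s\<inverse>] - [1]\<close> dies.
  Left translations, from which \<open>D\<close> is built, are in general not morphisms of the orbit
  category, but they commute with all morphisms.

  Flatness speaks of short exact sequences whose modules share one type of values, so it cannot be
  applied to \<open>D\<close> alone: \<open>D\<close> is completed by its cokernel, and both modules
  are copied into that type.\<close>

lemma hom_image_generate_subset:
  assumes "group G" "group H" "f \<in> hom G H" "R \<subseteq> carrier G" "subgroup K H" "f ` R \<subseteq> K"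
  shows "f ` generate G R \<subseteq> K"
proof -
  interpret group_hom G H f using assms by (simp add: group_hom_def group_hom_axioms_def)
  show ?thesis using assms by (metis generate_img H.generate_subgroup_incl)
qed

text \<open>As \<open>f\<close> maps \<open>K\<close> into \<open>L\<close>, all \<open>f y\<close>
  with \<open>y\<close> in one coset of \<open>K\<close> lie in one coset of \<open>L\<close>. The
  set under \<open>the_elem\<close> is thus a singleton, and any representative computes the
  value.\<close>

lemma quotient_map_rcoset:
  assumes "comm_group G" "comm_group H" "f \<in> hom G H" "subgroup K G" "subgroup L H" "f ` K \<subseteq> L"
    and x: "x \<in> carrier G"
  shows "quotient_map H L f (K #>\<^bsub>G\<^esub> x) = L #>\<^bsub>H\<^esub> f x"
proof -
  interpret G: comm_group G by fact
  interpret H: comm_group H by fact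
  interpret group_hom G H f using assms by (simp add: group_hom_def group_hom_axioms_def)
  interpret K: subgroup K G by fact
  interpret L: subgroup L H by fact
  have "L #>\<^bsub>H\<^esub> f y = L #>\<^bsub>H\<^esub> f x" if y: "y \<in> K #>\<^bsub>G\<^esub> x" for y
  proof -
    obtain k where k: "k \<in> K" "y = k \<otimes>\<^bsub>G\<^esub> x" using y unfolding r_coset_def by auto
    have fk: "f k \<in> L" using k assms(6) by auto
    have "f y = f k \<otimes>\<^bsub>H\<^esub> f x" using k x by simp
    then have "f y \<in> L #>\<^bsub>H\<^esub> f x" using fk by (auto simp: r_coset_def)
    then show ?thesis using H.repr_independence[OF _ _ assms(5)] x by force
  qed
  moreover have "x \<in> K #>\<^bsub>G\<^esub> x" using G.rcos_self[OF x assms(4)] .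
  ultimately show ?thesis unfolding quotient_map_def
    by (metis (no_types, lifting) empty_iff the_elem_image_unique)
qed

lemma quotient_map_hom:
  assumes "comm_group G" "comm_group H" "f \<in> hom G H" "subgroup K G" "subgroup L H" "f ` K \<subseteq> L"
  shows "quotient_map H L f \<in> hom (G Mod K) (H Mod L)"
proof -
  interpret G: comm_group G by fact
  interpret H: comm_group H by fact
  interpret group_hom G H f using assms by (simp add: group_hom_def group_hom_axioms_def)
  interpret K: normal K G using G.subgroup_imp_normal[OF assms(4)] .
  interpret L: normal L H using H.subgroup_imp_normal[OF assms(5)] .
  note q = quotient_map_rcoset[OF assms]
  show ?thesis
    by (rule homI) (auto simp: carrier_FactGroup q K.rcos_sum L.rcos_sum)
qed

lemma quotient_universal:
  assumes "comm_group G" "group H" "f \<in> hom G H" "subgroup K G" "f ` K \<subseteq> {\<one>\<^bsub>H\<^esub>}"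
  obtains g where "g \<in> hom (G Mod K) H" "\<And>x. x \<in> carrier G \<Longrightarrow> g (K #>\<^bsub>G\<^esub> x) = f x"
proof -
  interpret G: comm_group G by fact
  interpret group_hom G H f using assms by (simp add: group_hom_def group_hom_axioms_def)
  have "K \<lhd> G" by (rule G.subgroup_imp_normal) fact
  moreover have "K \<subseteq> kernel G H f"
    using assms subgroup.subset[OF assms(4)] by (auto simp: kernel_def)
  ultimately show thesis using FactGroup_universal_kernel that by metis
qed

text \<open>The union of the cosets belonging to \<open>Z\<close> is a subgroup of \<open>G\<close>
  that contains \<open>R\<close>, hence everything. Generation by \<open>R\<close> is phrased
  through subgroups, a form that passes easily from pure tensors to direct sums and
  quotients.\<close>

lemma subgroup_Mod_eq_carrier:
  assumes "comm_group G" "subgroup K G" "subgroup Z (G Mod K)"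
    and "\<And>Y. \<lbrakk>subgroup Y G; R \<subseteq> Y\<rbrakk> \<Longrightarrow> Y = carrier G" "R \<subseteq> carrier G"
    and "\<And>x. x \<in> R \<Longrightarrow> K #>\<^bsub>G\<^esub> x \<in> Z"
  shows "Z = carrier (G Mod K)"
proof -
  interpret G: comm_group G by fact
  interpret K: normal K G using G.subgroup_imp_normal[OF assms(2)] .
  have "subgroup (\<Union>Z) G" using K.factgroup_subgroup_union_subgroup[OF assms(3)] .
  moreover have eq: "\<Union>Z = {x \<in> carrier G. K #>\<^bsub>G\<^esub> x \<in> Z}" 
    using K.factgroup_subgroup_union_char[OF assms(3)] .
  ultimately have "\<Union>Z = carrier G" using assms(4)[of "\<Union>Z"] assms(5,6) by blast
  then have "carrier (G Mod K) \<subseteq> Z" using eq by (auto simp: carrier_FactGroup)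
  then show ?thesis using subgroup.subset[OF assms(3)] by auto
qed

section \<open>Tensor products of abelian groups\<close>

lemma bilinear_relationsI:
  "\<lbrakk>a \<in> carrier A; a' \<in> carrier A; b \<in> carrier B\<rbrakk> \<Longrightarrow>
    frag_of (a \<otimes>\<^bsub>A\<^esub> a', b) - frag_of (a, b) - frag_of (a', b) \<in> bilinear_relations A B"
  "\<lbrakk>a \<in> carrier A; b \<in> carrier B; b' \<in> carrier B\<rbrakk> \<Longrightarrow>
    frag_of (a, b \<otimes>\<^bsub>B\<^esub> b') - frag_of (a, b) - frag_of (a, b') \<in> bilinear_relations A B"
  by (auto simp: bilinear_relations_def)

locale tensor_pair = A: comm_group A + B: comm_group B for A :: "'m monoid" and B :: "'n monoid"
begin

sublocale P: comm_group "pairs_group A B" by (rule abelian_free_Abelian_group)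

lemma bilinear_relations_subset: "bilinear_relations A B \<subseteq> carrier (pairs_group A B)"
proof -
  have "frag_of x - frag_of y - frag_of z \<in> carrier (pairs_group A B)"
    if "x \<in> carrier A \<times> carrier B" "y \<in> carrier A \<times> carrier B" "z \<in> carrier A \<times> carrier B" for x y z
    using that keys_diff[of "frag_of x - frag_of y" "frag_of z"] keys_diff[of "frag_of x" "frag_of y"]
    by (auto split: if_splits)
  then show ?thesis by (auto simp: bilinear_relations_def simp del: carrier_free_Abelian_group_iff)
qed

lemma bilinear_kernel_subgroup: "subgroup (bilinear_kernel A B) (pairs_group A B)"
  unfolding bilinear_kernel_def by (rule P.generate_is_subgroup[OF bilinear_relations_subset])

sublocale K: normal "bilinear_kernel A B" "pairs_group A B"
  by (rule P.subgroup_imp_normal[OF bilinear_kernel_subgroup])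

sublocale T: comm_group "tensor_group A B"
  unfolding tensor_group_def by (rule P.abelian_FactGroup[OF bilinear_kernel_subgroup])

lemma pure_tensor_closed:
  "\<lbrakk>a \<in> carrier A; b \<in> carrier B\<rbrakk> \<Longrightarrow> pure_tensor A B a b \<in> carrier (tensor_group A B)"
  by (auto simp: pure_tensor_def tensor_group_def carrier_FactGroup)

lemma rcoset_eqI:
  assumes "x - y - z \<in> bilinear_relations A B" "x \<in> carrier (pairs_group A B)"
    "y \<in> carrier (pairs_group A B)" "z \<in> carrier (pairs_group A B)"
  shows "bilinear_kernel A B #>\<^bsub>pairs_group A B\<^esub> x =
    (bilinear_kernel A B #>\<^bsub>pairs_group A B\<^esub> y) \<otimes>\<^bsub>tensor_group A B\<^esub> (bilinear_kernel A B #>\<^bsub>pairs_group A B\<^esub> z)"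
proof -
  have k: "x - y - z \<in> bilinear_kernel A B" using assms(1) by (auto simp: bilinear_kernel_def generate.incl)
  have "x = (x - y - z) \<otimes>\<^bsub>pairs_group A B\<^esub> (y \<otimes>\<^bsub>pairs_group A B\<^esub> z)" by simp
  then have "x \<in> bilinear_kernel A B #>\<^bsub>pairs_group A B\<^esub> (y \<otimes>\<^bsub>pairs_group A B\<^esub> z)"
    using k unfolding r_coset_def by blast
  then have "bilinear_kernel A B #>\<^bsub>pairs_group A B\<^esub> x = bilinear_kernel A B #>\<^bsub>pairs_group A B\<^esub> (y \<otimes>\<^bsub>pairs_group A B\<^esub> z)"
    using P.repr_independence[OF _ _ bilinear_kernel_subgroup] assms P.m_closed by metis
  then show ?thesis using assms K.rcos_sum by (simp add: tensor_group_def)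
qed

lemma pure_tensor_mult_left:
  assumes "a \<in> carrier A" "a' \<in> carrier A" "b \<in> carrier B"
  shows "pure_tensor A B (a \<otimes>\<^bsub>A\<^esub> a') b = pure_tensor A B a b \<otimes>\<^bsub>tensor_group A B\<^esub> pure_tensor A B a' b"
  unfolding pure_tensor_def
  by (rule rcoset_eqI) (use assms in \<open>auto intro!: bilinear_relationsI\<close>)

lemma pure_tensor_mult_right:
  assumes "a \<in> carrier A" "b \<in> carrier B" "b' \<in> carrier B"
  shows "pure_tensor A B a (b \<otimes>\<^bsub>B\<^esub> b') = pure_tensor A B a b \<otimes>\<^bsub>tensor_group A B\<^esub> pure_tensor A B a b'"
  unfolding pure_tensor_def
  by (rule rcoset_eqI) (use assms in \<open>auto intro!: bilinear_relationsI\<close>)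

lemma tensor_group_generated:
  assumes "subgroup Z (tensor_group A B)"
    and "\<And>a b. \<lbrakk>a \<in> carrier A; b \<in> carrier B\<rbrakk> \<Longrightarrow> pure_tensor A B a b \<in> Z"
  shows "Z = carrier (tensor_group A B)"
  unfolding tensor_group_def
proof (rule subgroup_Mod_eq_carrier[OF P.comm_group_axioms bilinear_kernel_subgroup,
        where R = "frag_of ` (carrier A \<times> carrier B)"])
  fix Y assume Y: "subgroup Y (pairs_group A B)" "frag_of ` (carrier A \<times> carrier B) \<subseteq> Y"
  have "x \<in> Y" if "Poly_Mapping.keys x \<subseteq> carrier A \<times> carrier B" for x
    using that
  proof (induction rule: frag_induction)
    case zero show ?case using subgroup.one_closed[OF Y(1)] by simp
  next
    case (one a) then show ?case using Y by auto
  next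
    case (diff x y)
    then have "x \<otimes>\<^bsub>pairs_group A B\<^esub> inv\<^bsub>pairs_group A B\<^esub> y \<in> Y"
      by (intro subgroup.m_closed[OF Y(1)] subgroup.m_inv_closed[OF Y(1)])
    then show ?case using diff subgroup.mem_carrier[OF Y(1)] by simp
  qed
  then show "Y = carrier (pairs_group A B)" using subgroup.subset[OF Y(1)] by auto
qed (use assms in \<open>auto simp: tensor_group_def pure_tensor_def\<close>)

text \<open>A bilinear \<open>f\<close> extends to the free abelian group on pairs. On both kinds of
  relations the extension takes values of the form \<open>x y x\<inverse> y\<inverse>\<close>,
  trivial because \<open>C\<close> is commutative, so it descends to the quotient.\<close>

lemma tensor_group_universal:
  assumes "comm_group C"
    and f: "\<And>a b. \<lbrakk>a \<in> carrier A; b \<in> carrier B\<rbrakk> \<Longrightarrow> f a b \<in> carrier C"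
    and fl: "\<And>a a' b. \<lbrakk>a \<in> carrier A; a' \<in> carrier A; b \<in> carrier B\<rbrakk> \<Longrightarrow> f (a \<otimes>\<^bsub>A\<^esub> a') b = f a b \<otimes>\<^bsub>C\<^esub> f a' b"
    and fr: "\<And>a b b'. \<lbrakk>a \<in> carrier A; b \<in> carrier B; b' \<in> carrier B\<rbrakk> \<Longrightarrow> f a (b \<otimes>\<^bsub>B\<^esub> b') = f a b \<otimes>\<^bsub>C\<^esub> f a b'"
  obtains h where "h \<in> hom (tensor_group A B) C"
    "\<And>a b. \<lbrakk>a \<in> carrier A; b \<in> carrier B\<rbrakk> \<Longrightarrow> h (pure_tensor A B a b) = f a b"
proof -
  interpret C: comm_group C by fact
  have "case_prod f ` (carrier A \<times> carrier B) \<subseteq> carrier C" using f by auto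
  then obtain g where g: "g \<in> hom (pairs_group A B) C" "\<And>x. x \<in> carrier A \<times> carrier B \<Longrightarrow> g (frag_of x) = case_prod f x"
    using C.free_Abelian_group_universal by metis
  interpret g: group_hom "pairs_group A B" C g using g by (simp add: group_hom_def group_hom_axioms_def P.is_group)
  have gd: "g (frag_of x - frag_of y - frag_of z) = g (frag_of x) \<otimes>\<^bsub>C\<^esub> inv\<^bsub>C\<^esub> g (frag_of y) \<otimes>\<^bsub>C\<^esub> inv\<^bsub>C\<^esub> g (frag_of z)"
    if "x \<in> carrier A \<times> carrier B" "y \<in> carrier A \<times> carrier B" "z \<in> carrier A \<times> carrier B" for x y z
  proof -
    let ?P = "pairs_group A B"
    have "g ((frag_of x \<otimes>\<^bsub>?P\<^esub> inv\<^bsub>?P\<^esub> frag_of y) \<otimes>\<^bsub>?P\<^esub> inv\<^bsub>?P\<^esub> frag_of z) =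
      g (frag_of x) \<otimes>\<^bsub>C\<^esub> inv\<^bsub>C\<^esub> g (frag_of y) \<otimes>\<^bsub>C\<^esub> inv\<^bsub>C\<^esub> g (frag_of z)"
      using that by (simp only: g.hom_mult g.hom_inv P.m_closed P.inv_closed frag_of_in_free_Abelian_group)
    then show ?thesis using that by (simp add: diff_conv_add_uminus del: add_uminus_conv_diff)
  qed
  have cancel: "x \<otimes>\<^bsub>C\<^esub> y \<otimes>\<^bsub>C\<^esub> inv\<^bsub>C\<^esub> x \<otimes>\<^bsub>C\<^esub> inv\<^bsub>C\<^esub> y = \<one>\<^bsub>C\<^esub>" if "x \<in> carrier C" "y \<in> carrier C" for x y
    using that by (metis C.inv_closed C.inv_mult C.m_assoc C.m_closed C.r_inv)
  have "g ` bilinear_relations A B \<subseteq> {\<one>\<^bsub>C\<^esub>}"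
    unfolding bilinear_relations_def using f fl fr by (auto simp: gd g(2) cancel)
  then have "g ` bilinear_kernel A B \<subseteq> {\<one>\<^bsub>C\<^esub>}"
    unfolding bilinear_kernel_def
    by (intro hom_image_generate_subset[OF P.is_group C.is_group g(1)] bilinear_relations_subset C.triv_subgroup)
  then obtain h where "h \<in> hom (tensor_group A B) C"
     "\<And>x. x \<in> carrier (pairs_group A B) \<Longrightarrow> h (bilinear_kernel A B #>\<^bsub>pairs_group A B\<^esub> x) = g x"
    unfolding tensor_group_def
    using quotient_universal[OF P.comm_group_axioms C.is_group g(1) bilinear_kernel_subgroup] by metis
  then show thesis using that[of h] g(2) by (simp add: pure_tensor_def)
qed

end

text \<open>Applying \<open>h\<close> to the second entries turns a bilinear relation into one of
  the same kind, hence the kernel is mapped into the kernel and the induced map can be computed on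
  representatives.\<close>

lemma tensor_group_map:
  assumes "comm_group A" "comm_group B" "comm_group B'" and h: "h \<in> hom B B'"
  shows tensor_group_map_hom: "tensor_group_map A B' h \<in> hom (tensor_group A B) (tensor_group A B')" (is ?t1)
    and tensor_group_map_pure: "\<And>a b. \<lbrakk>a \<in> carrier A; b \<in> carrier B\<rbrakk> \<Longrightarrow>
      tensor_group_map A B' h (pure_tensor A B a b) = pure_tensor A B' a (h b)" (is "\<And>a b. PROP ?t2 a b")
proof -
  interpret B: tensor_pair A B using assms by (simp add: tensor_pair_def)
  interpret B': tensor_pair A B' using assms by (simp add: tensor_pair_def)
  let ?f = "frag_extend (\<lambda>(a, b). frag_of (a, h b)) :: _ \<Rightarrow> _ \<Rightarrow>\<^sub>0 int"
  have hb: "h b \<in> carrier B'" if "b \<in> carrier B" for b using h that by (auto simp: hom_def)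
  have hm: "h (b \<otimes>\<^bsub>B\<^esub> b') = h b \<otimes>\<^bsub>B'\<^esub> h b'" if "b \<in> carrier B" "b' \<in> carrier B" for b b'
    using h that by (auto simp: hom_def)
  have f: "?f \<in> hom (pairs_group A B) (pairs_group A B')"
  proof (rule homI)
    fix x assume "x \<in> carrier (pairs_group A B)"
    then have "(\<Union>p \<in> Poly_Mapping.keys x. Poly_Mapping.keys ((\<lambda>(a, b). frag_of (a, h b)) p)) \<subseteq> carrier A \<times> carrier B'"
      using hb by (auto split: prod.splits)
    then show "?f x \<in> carrier (pairs_group A B')"
      using keys_frag_extend[of "\<lambda>(a, b). frag_of (a, h b)" x] by (simp add: subset_trans)
  qed (simp add: frag_extend_add)
  have "?f ` bilinear_relations A B \<subseteq> bilinear_relations A B'"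
  proof (rule image_subsetI)
    fix z assume "z \<in> bilinear_relations A B"
    then consider a a' b where "a \<in> carrier A" "a' \<in> carrier A" "b \<in> carrier B"
        "z = frag_of (a \<otimes>\<^bsub>A\<^esub> a', b) - frag_of (a, b) - frag_of (a', b)"
      | a b b' where "a \<in> carrier A" "b \<in> carrier B" "b' \<in> carrier B"
        "z = frag_of (a, b \<otimes>\<^bsub>B\<^esub> b') - frag_of (a, b) - frag_of (a, b')"
      unfolding bilinear_relations_def by blast
    then show "?f z \<in> bilinear_relations A B'"
      by cases (simp_all add: frag_extend_diff hm hb bilinear_relationsI)
  qed
  then have "?f ` bilinear_relations A B \<subseteq> bilinear_kernel A B'"
    by (auto simp: bilinear_kernel_def intro: generate.incl)
  then have k: "?f ` bilinear_kernel A B \<subseteq> bilinear_kernel A B'"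
    unfolding bilinear_kernel_def[of A B]
    by (intro hom_image_generate_subset[OF B.P.is_group B'.P.is_group f] B.bilinear_relations_subset B'.bilinear_kernel_subgroup)
  note facts = B.P.comm_group_axioms B'.P.comm_group_axioms f B.bilinear_kernel_subgroup B'.bilinear_kernel_subgroup k
  show ?t1 unfolding tensor_group_map_def tensor_group_def by (rule quotient_map_hom[OF facts])
  show "PROP ?t2 a b" for a b
    unfolding tensor_group_map_def pure_tensor_def by (subst quotient_map_rcoset[OF facts]) auto
qed

section \<open>Direct sums\<close>

definition sum_inclusion :: "'i set \<Rightarrow> ('i \<Rightarrow> ('b, 'c) monoid_scheme) \<Rightarrow> 'i \<Rightarrow> 'b \<Rightarrow> 'i \<Rightarrow> 'b" where
  "sum_inclusion I A i x = (\<lambda>j\<in>I. if j = i then x else \<one>\<^bsub>A j\<^esub>)"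

lemma comm_group_product_group:
  assumes "\<And>i. i \<in> I \<Longrightarrow> comm_group (A i)"
  shows "comm_group (product_group I A)"
proof (rule group.group_comm_groupI)
  show "Group.group (product_group I A)" using assms by (simp add: comm_group.axioms(2))
qed (auto intro!: restrict_ext comm_groupE(4)[OF assms])

lemma comm_group_sum_group:
  assumes "\<And>i. i \<in> I \<Longrightarrow> comm_group (A i)"
  shows "comm_group (sum_group I A)"
  unfolding sum_group_def
  by (intro group.abelian_subgroup_generated comm_group_product_group comm_group.axioms(2) assms)

lemma sum_inclusion_hom:
  assumes "\<And>i. i \<in> I \<Longrightarrow> Group.group (A i)" "i \<in> I"
  shows "sum_inclusion I A i \<in> hom (A i) (sum_group I A)"
proof (rule homI)
  fix x assume x: "x \<in> carrier (A i)"
  have "finite {j \<in> I. sum_inclusion I A i x j \<noteq> \<one>\<^bsub>A j\<^esub>}"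
    by (rule finite_subset[of _ "{i}"]) (auto simp: sum_inclusion_def)
  then show "sum_inclusion I A i x \<in> carrier (sum_group I A)"
    using assms x by (auto simp: carrier_sum_group sum_inclusion_def group.is_monoid)
qed (auto simp: sum_inclusion_def assms group.is_monoid)

text \<open>Induction on a finite set \<open>J\<close> that contains the support. \<open>J\<close>
  may be larger than the support and may leave \<open>I\<close>, so one index can be removed at a
  time: \<open>s\<close> is the product of \<open>s\<close> with its coordinate at \<open>j\<close>
  reset and of the inclusion of \<open>s j\<close>.\<close>

lemma sum_group_generated:
  assumes A: "\<And>i. i \<in> I \<Longrightarrow> Group.group (A i)" and Z: "subgroup Z (sum_group I A)"
    and inc: "\<And>i x. \<lbrakk>i \<in> I; x \<in> carrier (A i)\<rbrakk> \<Longrightarrow> sum_inclusion I A i x \<in> Z"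
  shows "Z = carrier (sum_group I A)"
proof -
  have "s \<in> Z" if "finite J" "s \<in> carrier (sum_group I A)" "{i \<in> I. s i \<noteq> \<one>\<^bsub>A i\<^esub>} \<subseteq> J" for s J
    using that
  proof (induction J arbitrary: s rule: finite_induct)
    case empty
    then have "s = \<one>\<^bsub>sum_group I A\<^esub>"
      using A by (auto simp: carrier_sum_group PiE_iff extensional_def fun_eq_iff)
    then show ?case using subgroup.one_closed[OF Z] by blast
  next
    case (insert j J)
    show ?case
    proof (cases "j \<in> I")
      case True
      let ?s = "s(j := \<one>\<^bsub>A j\<^esub>)"
      have sj: "s j \<in> carrier (A j)" using insert.prems A True by (auto simp: carrier_sum_group)
      have "finite {i \<in> I. ?s i \<noteq> \<one>\<^bsub>A i\<^esub>}"
        by (rule finite_subset[of _ "{i \<in> I. s i \<noteq> \<one>\<^bsub>A i\<^esub>}"])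
           (use insert.prems A in \<open>auto simp: carrier_sum_group\<close>)
      then have "?s \<in> carrier (sum_group I A)"
        using insert.prems A True by (auto simp: carrier_sum_group PiE_iff extensional_def group.is_monoid)
      moreover have "{i \<in> I. ?s i \<noteq> \<one>\<^bsub>A i\<^esub>} \<subseteq> J" using insert.prems by auto
      ultimately have "?s \<in> Z" using insert.IH by blast
      moreover have "sum_inclusion I A j (s j) \<in> Z" using inc True sj by blast
      ultimately have "?s \<otimes>\<^bsub>sum_group I A\<^esub> sum_inclusion I A j (s j) \<in> Z"
        using subgroup.m_closed[OF Z] by blast
      moreover have "?s \<otimes>\<^bsub>sum_group I A\<^esub> sum_inclusion I A j (s j) = s"
        using insert.prems A True
        by (auto simp: sum_inclusion_def carrier_sum_group PiE_iff extensional_def fun_eq_iff group.is_monoid)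
      ultimately show ?thesis by simp
    next
      case False
      then show ?thesis using insert.IH[OF insert.prems(1)] insert.prems by blast
    qed
  qed
  then have "carrier (sum_group I A) \<subseteq> Z" using A by (auto simp: carrier_sum_group)
  then show ?thesis using subgroup.subset[OF Z] by auto
qed

lemma sum_group_universal:
  assumes "comm_group C" and A: "\<And>i. i \<in> I \<Longrightarrow> Group.group (A i)"
    and f: "\<And>i. i \<in> I \<Longrightarrow> f i \<in> hom (A i) C"
  obtains h where "h \<in> hom (sum_group I A) C"
    "\<And>i x. \<lbrakk>i \<in> I; x \<in> carrier (A i)\<rbrakk> \<Longrightarrow> h (sum_inclusion I A i x) = f i x"
proof -
  interpret C: comm_group C by fact
  \<comment> \<open>On an element of the direct sum only finitely many factors are non-trivial, so
    this product over a possibly infinite index set is a finite product.\<close>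
  let ?h = "\<lambda>x. gfinprod C (\<lambda>i. f i (x i)) I"
  have "?h (sum_inclusion I A i x) = f i x" if i: "i \<in> I" and x: "x \<in> carrier (A i)" for i x
  proof -
    have fx: "f i x \<in> carrier C" using f[OF i] x by (auto simp: hom_def)
    have one: "f j \<one>\<^bsub>A j\<^esub> = \<one>\<^bsub>C\<^esub>" if "j \<in> I" for j using hom_one[OF f A C.is_group] that by blast
    have eq: "f j (sum_inclusion I A i x j) = (if j = i then f i x else \<one>\<^bsub>C\<^esub>)" if "j \<in> I" for j
      using that one by (simp add: sum_inclusion_def)
    have "?h (sum_inclusion I A i x) = gfinprod C (\<lambda>j. if j = i then f i x else \<one>\<^bsub>C\<^esub>) I"
      using fx by (intro C.gfinprod_cong) (auto simp: simp_implies_def eq)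
    also have "\<dots> = gfinprod C (\<lambda>j. f i x) {i}"
      using fx i by (intro C.gfinprod_mono_neutral_cong_right) auto
    also have "\<dots> = f i x" using fx by simp
    finally show ?thesis .
  qed
  then show thesis using that[of ?h] C.hom_group_sum[of I f A] f A by blast
qed

section \<open>Tensor products of modules over the orbit category\<close>

locale module_pair =
  fixes G :: "('a, 'b) monoid_scheme" and F :: "'a set set"
    and M :: "('a, 'm) orbit_module" and N :: "('a, 'n) orbit_module"
  assumes right: "right_module G F M" and left: "left_module G F N"
begin

abbreviation "tensor_at U \<equiv> tensor_group (mval M U) (mval N U)"

text \<open>The element m \<otimes> n, taken at \<open>U\<close>, of the tensor product over the
  orbit category. Once the lemmas on generation, universality and induced maps are available, these
  classes replace explicit cosets of direct sums.\<close>

definition class_tensor where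
  "class_tensor U m n = balancing_kernel G F M N #>\<^bsub>tensor_sum G F M N\<^esub> summand_tensor G F M N U m n"

lemma tensor_pair_at: "U \<in> orbit_objects G F \<Longrightarrow> tensor_pair (mval M U) (mval N U)"
  using right left by (simp add: tensor_pair_def right_module_def left_module_def)

lemma right_act_closed:
  "\<lbrakk>U \<in> orbit_objects G F; V \<in> orbit_objects G F; \<phi> \<in> orbit_hom G U V; m \<in> carrier (mval M V)\<rbrakk>
    \<Longrightarrow> mact M U V \<phi> m \<in> carrier (mval M U)"
  using right hom_in_carrier[of "mact M U V \<phi>" "mval M V" "mval M U"] by (simp add: right_module_def)

lemma left_act_closed:
  "\<lbrakk>U \<in> orbit_objects G F; V \<in> orbit_objects G F; \<phi> \<in> orbit_hom G U V; n \<in> carrier (mval N U)\<rbrakk>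
    \<Longrightarrow> mact N U V \<phi> n \<in> carrier (mval N V)"
  using left hom_in_carrier[of "mact N U V \<phi>" "mval N U" "mval N V"] by (simp add: left_module_def)

lemma group_tensor_at: "U \<in> orbit_objects G F \<Longrightarrow> comm_group (tensor_at U)"
  using tensor_pair_at tensor_pair.axioms tensor_pair_def
  by (metis bilinear_kernel_def comm_group.abelian_FactGroup tensor_pair.bilinear_kernel_subgroup abelian_free_Abelian_group tensor_group_def)

lemma group_tensor_at': "U \<in> orbit_objects G F \<Longrightarrow> Group.group (tensor_at U)"
  by (simp add: group_tensor_at comm_group.axioms(2))

sublocale S: comm_group "tensor_sum G F M N"
  unfolding tensor_sum_def by (rule comm_group_sum_group[OF group_tensor_at])

lemma summand_tensor_eq:
  "summand_tensor G F M N U m n =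
    sum_inclusion (orbit_objects G F) tensor_at U (pure_tensor (mval M U) (mval N U) m n)"
  by (simp add: summand_tensor_def sum_inclusion_def)

lemma pure_closed:
  "\<lbrakk>U \<in> orbit_objects G F; m \<in> carrier (mval M U); n \<in> carrier (mval N U)\<rbrakk>
    \<Longrightarrow> pure_tensor (mval M U) (mval N U) m n \<in> carrier (tensor_at U)"
  using tensor_pair.pure_tensor_closed[OF tensor_pair_at] .

lemma inclusion_hom:
  "U \<in> orbit_objects G F \<Longrightarrow>
    sum_inclusion (orbit_objects G F) tensor_at U \<in> hom (tensor_at U) (tensor_sum G F M N)"
  unfolding tensor_sum_def by (rule sum_inclusion_hom[OF group_tensor_at'])

lemma summand_tensor_closed:
  assumes "U \<in> orbit_objects G F" "m \<in> carrier (mval M U)" "n \<in> carrier (mval N U)"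
  shows "summand_tensor G F M N U m n \<in> carrier (tensor_sum G F M N)"
  unfolding summand_tensor_eq using hom_in_carrier[OF inclusion_hom] pure_closed assms by blast

lemma balancing_relations_subset: "balancing_relations G F M N \<subseteq> carrier (tensor_sum G F M N)"
  unfolding balancing_relations_def
  by (auto intro!: S.m_closed S.inv_closed summand_tensor_closed left_act_closed right_act_closed)

lemma balancing_kernel_subgroup: "subgroup (balancing_kernel G F M N) (tensor_sum G F M N)"
  unfolding balancing_kernel_def by (rule S.generate_is_subgroup[OF balancing_relations_subset])

sublocale K: normal "balancing_kernel G F M N" "tensor_sum G F M N"
  by (rule S.subgroup_imp_normal[OF balancing_kernel_subgroup])

sublocale T: comm_group "module_tensor G F M N"
  unfolding module_tensor_def by (rule S.abelian_FactGroup[OF balancing_kernel_subgroup])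

lemma class_tensor_closed:
  "\<lbrakk>U \<in> orbit_objects G F; m \<in> carrier (mval M U); n \<in> carrier (mval N U)\<rbrakk>
    \<Longrightarrow> class_tensor U m n \<in> carrier (module_tensor G F M N)"
  by (auto simp: class_tensor_def module_tensor_def carrier_FactGroup intro!: summand_tensor_closed)

lemma class_tensor_mult_left:
  assumes "U \<in> orbit_objects G F" "m \<in> carrier (mval M U)" "m' \<in> carrier (mval M U)" "n \<in> carrier (mval N U)"
  shows "class_tensor U (m \<otimes>\<^bsub>mval M U\<^esub> m') n =
    class_tensor U m n \<otimes>\<^bsub>module_tensor G F M N\<^esub> class_tensor U m' n"
proof -
  interpret t: tensor_pair "mval M U" "mval N U" by (rule tensor_pair_at) fact
  show ?thesis using assms
    by (simp add: class_tensor_def summand_tensor_eq t.pure_tensor_mult_left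
        hom_mult[OF inclusion_hom] pure_closed module_tensor_def K.rcos_sum
        hom_in_carrier[OF inclusion_hom])
qed

lemma class_tensor_mult_right:
  assumes "U \<in> orbit_objects G F" "m \<in> carrier (mval M U)" "n \<in> carrier (mval N U)" "n' \<in> carrier (mval N U)"
  shows "class_tensor U m (n \<otimes>\<^bsub>mval N U\<^esub> n') =
    class_tensor U m n \<otimes>\<^bsub>module_tensor G F M N\<^esub> class_tensor U m n'"
proof -
  interpret t: tensor_pair "mval M U" "mval N U" by (rule tensor_pair_at) fact
  show ?thesis using assms
    by (simp add: class_tensor_def summand_tensor_eq t.pure_tensor_mult_right
        hom_mult[OF inclusion_hom] pure_closed module_tensor_def K.rcos_sum
        hom_in_carrier[OF inclusion_hom])
qed

lemma class_tensor_balanced: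
  assumes "U \<in> orbit_objects G F" "V \<in> orbit_objects G F" "\<phi> \<in> orbit_hom G U V"
    "m \<in> carrier (mval M V)" "n \<in> carrier (mval N U)"
  shows "class_tensor U (mact M U V \<phi> m) n = class_tensor V m (mact N U V \<phi> n)"
proof -
  let ?S = "tensor_sum G F M N"
  let ?x = "summand_tensor G F M N U (mact M U V \<phi> m) n"
    and ?y = "summand_tensor G F M N V m (mact N U V \<phi> n)"
  have c: "?x \<in> carrier ?S" "?y \<in> carrier ?S"
    using assms by (auto intro!: summand_tensor_closed left_act_closed right_act_closed)
  have "?x \<otimes>\<^bsub>?S\<^esub> inv\<^bsub>?S\<^esub> ?y \<in> balancing_relations G F M N"
    using assms unfolding balancing_relations_def by blast
  then have "?x \<otimes>\<^bsub>?S\<^esub> inv\<^bsub>?S\<^esub> ?y \<in> balancing_kernel G F M N"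
    by (auto simp: balancing_kernel_def intro: generate.incl)
  then have "?x \<in> balancing_kernel G F M N #>\<^bsub>?S\<^esub> ?y"
    using K.rcos_module[OF S.is_group c(2,1)] by blast
  then show ?thesis unfolding class_tensor_def
    using S.repr_independence[OF _ c(2) balancing_kernel_subgroup] by simp
qed

lemma module_tensor_generated:
  assumes "subgroup Z (module_tensor G F M N)"
    and cl: "\<And>U m n. \<lbrakk>U \<in> orbit_objects G F; m \<in> carrier (mval M U); n \<in> carrier (mval N U)\<rbrakk>
      \<Longrightarrow> class_tensor U m n \<in> Z"
  shows "Z = carrier (module_tensor G F M N)"
  unfolding module_tensor_def
proof (rule subgroup_Mod_eq_carrier[OF S.comm_group_axioms balancing_kernel_subgroup,
        where R = "{summand_tensor G F M N U m n | U m n.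
          U \<in> orbit_objects G F \<and> m \<in> carrier (mval M U) \<and> n \<in> carrier (mval N U)}"])
  fix Y assume Y: "subgroup Y (tensor_sum G F M N)"
    "{summand_tensor G F M N U m n | U m n.
      U \<in> orbit_objects G F \<and> m \<in> carrier (mval M U) \<and> n \<in> carrier (mval N U)} \<subseteq> Y"
  have "sum_inclusion (orbit_objects G F) tensor_at U x \<in> Y"
    if U: "U \<in> orbit_objects G F" and x: "x \<in> carrier (tensor_at U)" for U x
  proof -
    interpret t: tensor_pair "mval M U" "mval N U" by (rule tensor_pair_at) fact
    interpret i: group_hom "tensor_at U" "tensor_sum G F M N" "sum_inclusion (orbit_objects G F) tensor_at U"
      using inclusion_hom[OF U] by (simp add: group_hom_def group_hom_axioms_def)
    \<comment> \<open>The part of the summand at \<open>U\<close> that lands in \<open>Y\<close>. It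
      is a subgroup containing all pure tensors, hence the whole summand.\<close>
    let ?X = "{x \<in> carrier (tensor_at U). sum_inclusion (orbit_objects G F) tensor_at U x \<in> Y}"
    have "subgroup ?X (tensor_at U)"
      using subgroup.m_closed[OF Y(1)] subgroup.m_inv_closed[OF Y(1)] subgroup.one_closed[OF Y(1)]
      by unfold_locales auto
    then have "?X = carrier (tensor_at U)"
      by (rule t.tensor_group_generated) (use U Y(2) pure_closed in \<open>auto simp: summand_tensor_eq\<close>)
    then show ?thesis using x by blast
  qed
  then show "Y = carrier (tensor_sum G F M N)"
    unfolding tensor_sum_def
    by (intro sum_group_generated[OF group_tensor_at']) (use Y(1) in \<open>auto simp: tensor_sum_def\<close>)
qed (use assms in \<open>auto simp: module_tensor_def class_tensor_def intro: summand_tensor_closed\<close>)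

text \<open>Three universal properties are chained: a bilinear map at each object gives a
  homomorphism on the tensor product there, these assemble on the direct sum, and \<open>bal\<close>
  makes the result trivial on the balancing relations.\<close>

lemma module_tensor_universal:
  assumes "comm_group C"
    and f: "\<And>U m n. \<lbrakk>U \<in> orbit_objects G F; m \<in> carrier (mval M U); n \<in> carrier (mval N U)\<rbrakk> \<Longrightarrow> f U m n \<in> carrier C"
    and fl: "\<And>U m m' n. \<lbrakk>U \<in> orbit_objects G F; m \<in> carrier (mval M U); m' \<in> carrier (mval M U); n \<in> carrier (mval N U)\<rbrakk>
      \<Longrightarrow> f U (m \<otimes>\<^bsub>mval M U\<^esub> m') n = f U m n \<otimes>\<^bsub>C\<^esub> f U m' n"
    and fr: "\<And>U m n n'. \<lbrakk>U \<in> orbit_objects G F; m \<in> carrier (mval M U); n \<in> carrier (mval N U); n' \<in> carrier (mval N U)\<rbrakk>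
      \<Longrightarrow> f U m (n \<otimes>\<^bsub>mval N U\<^esub> n') = f U m n \<otimes>\<^bsub>C\<^esub> f U m n'"
    and bal: "\<And>U V \<phi> m n. \<lbrakk>U \<in> orbit_objects G F; V \<in> orbit_objects G F; \<phi> \<in> orbit_hom G U V;
      m \<in> carrier (mval M V); n \<in> carrier (mval N U)\<rbrakk> \<Longrightarrow> f U (mact M U V \<phi> m) n = f V m (mact N U V \<phi> n)"
  obtains h where "h \<in> hom (module_tensor G F M N) C"
    "\<And>U m n. \<lbrakk>U \<in> orbit_objects G F; m \<in> carrier (mval M U); n \<in> carrier (mval N U)\<rbrakk>
      \<Longrightarrow> h (class_tensor U m n) = f U m n"
proof -
  interpret C: comm_group C by fact
  have "\<exists>k. k \<in> hom (tensor_at U) C \<and> (\<forall>m \<in> carrier (mval M U). \<forall>n \<in> carrier (mval N U).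
    k (pure_tensor (mval M U) (mval N U) m n) = f U m n)" if U: "U \<in> orbit_objects G F" for U
    by (rule tensor_pair.tensor_group_universal[OF tensor_pair_at[OF U] assms(1), of "f U"])
       (use f fl fr U in auto)
  then obtain k where k: "\<And>U. U \<in> orbit_objects G F \<Longrightarrow> k U \<in> hom (tensor_at U) C"
    "\<And>U m n. \<lbrakk>U \<in> orbit_objects G F; m \<in> carrier (mval M U); n \<in> carrier (mval N U)\<rbrakk>
      \<Longrightarrow> k U (pure_tensor (mval M U) (mval N U) m n) = f U m n"
    by metis
  have "\<exists>g. g \<in> hom (tensor_sum G F M N) C \<and> (\<forall>U\<in>orbit_objects G F. \<forall>x\<in>carrier (tensor_at U).
      g (sum_inclusion (orbit_objects G F) tensor_at U x) = k U x)"
    unfolding tensor_sum_def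
  proof (rule sum_group_universal[where f = k and A = tensor_at and I = "orbit_objects G F", OF assms(1)], goal_cases)
    case 1 then show ?case by (rule group_tensor_at')
  next
    case 2 then show ?case by (rule k(1))
  next
    case (3 h)
    then show ?case by auto
  qed
  then obtain g where "g \<in> hom (tensor_sum G F M N) C \<and> (\<forall>U\<in>orbit_objects G F. \<forall>x\<in>carrier (tensor_at U).
      g (sum_inclusion (orbit_objects G F) tensor_at U x) = k U x)" ..
  then have g: "g \<in> hom (tensor_sum G F M N) C"
    "\<And>U x. \<lbrakk>U \<in> orbit_objects G F; x \<in> carrier (tensor_at U)\<rbrakk>
      \<Longrightarrow> g (sum_inclusion (orbit_objects G F) tensor_at U x) = k U x"
    by simp_all
  have gs: "g (summand_tensor G F M N U m n) = f U m n"
    if "U \<in> orbit_objects G F" "m \<in> carrier (mval M U)" "n \<in> carrier (mval N U)" for U m n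
    using that by (simp add: summand_tensor_eq g pure_closed k)
  interpret g: group_hom "tensor_sum G F M N" C g
    using g by (simp add: group_hom_def group_hom_axioms_def)
  have "g ` balancing_relations G F M N \<subseteq> {\<one>\<^bsub>C\<^esub>}"
    unfolding balancing_relations_def
    using left_act_closed right_act_closed summand_tensor_closed bal f by (auto simp: gs)
  then have "g ` balancing_kernel G F M N \<subseteq> {\<one>\<^bsub>C\<^esub>}"
    unfolding balancing_kernel_def
    by (intro hom_image_generate_subset[OF S.is_group C.is_group g(1)] balancing_relations_subset C.triv_subgroup)
  then obtain h where "h \<in> hom (module_tensor G F M N) C"
    "\<And>x. x \<in> carrier (tensor_sum G F M N) \<Longrightarrow> h (balancing_kernel G F M N #>\<^bsub>tensor_sum G F M N\<^esub> x) = g x"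
    unfolding module_tensor_def
    using quotient_universal[OF S.comm_group_axioms C.is_group g(1) balancing_kernel_subgroup] by metis
  then show thesis using that[of h] by (simp add: class_tensor_def gs summand_tensor_closed)
qed

end

text \<open>Naturality of \<open>\<eta>\<close> carries each balancing relation for \<open>N\<close>
  to one for \<open>N'\<close>, so the coordinatewise map descends. Later arguments need only that
  it is a homomorphism and its value on the classes of m \<otimes> n.\<close>

lemma module_tensor_map:
  assumes M: "right_module G F M" and N: "left_module G F N" and N': "left_module G F N'"
    and \<eta>: "\<eta> \<in> left_module_hom G F N N'"
  shows module_tensor_map_hom:
      "module_tensor_map G F M N' \<eta> \<in> hom (module_tensor G F M N) (module_tensor G F M N')" (is ?t1)
    and module_tensor_map_class:
      "\<And>U m n. \<lbrakk>U \<in> orbit_objects G F; m \<in> carrier (mval M U); n \<in> carrier (mval N U)\<rbrakk> \<Longrightarrow>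
        module_tensor_map G F M N' \<eta> (module_pair.class_tensor G F M N U m n) =
        module_pair.class_tensor G F M N' U m (\<eta> U n)" (is "\<And>U m n. PROP ?t2 U m n")
proof -
  interpret N: module_pair G F M N using M N by (simp add: module_pair_def)
  interpret N': module_pair G F M N' using M N' by (simp add: module_pair_def)
  let ?I = "orbit_objects G F"
  let ?f = "\<lambda>s. \<lambda>U\<in>?I. tensor_group_map (mval M U) (mval N' U) (\<eta> U) (s U)"
  have \<eta>h: "\<eta> U \<in> hom (mval N U) (mval N' U)" if "U \<in> ?I" for U
    using \<eta> that by (simp add: left_module_hom_def)
  have \<eta>n: "\<eta> V (mact N U V \<phi> n) = mact N' U V \<phi> (\<eta> U n)"
    if "U \<in> ?I" "V \<in> ?I" "\<phi> \<in> orbit_hom G U V" "n \<in> carrier (mval N U)" for U V \<phi> n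
    using \<eta> that by (simp add: left_module_hom_def)
  have \<eta>c: "\<eta> U n \<in> carrier (mval N' U)" if "U \<in> ?I" "n \<in> carrier (mval N U)" for U n
    using hom_in_carrier[OF \<eta>h] that by blast
  have th: "tensor_group_map (mval M U) (mval N' U) (\<eta> U) \<in> hom (N.tensor_at U) (N'.tensor_at U)"
    and tp: "\<And>m n. \<lbrakk>m \<in> carrier (mval M U); n \<in> carrier (mval N U)\<rbrakk> \<Longrightarrow>
      tensor_group_map (mval M U) (mval N' U) (\<eta> U) (pure_tensor (mval M U) (mval N U) m n) =
      pure_tensor (mval M U) (mval N' U) m (\<eta> U n)" if "U \<in> ?I" for U
    using tensor_group_map[OF _ _ _ \<eta>h[OF that], of "mval M U"] M N N' that
    by (auto simp: right_module_def left_module_def)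
  have tone: "tensor_group_map (mval M U) (mval N' U) (\<eta> U) \<one>\<^bsub>N.tensor_at U\<^esub> = \<one>\<^bsub>N'.tensor_at U\<^esub>"
    if U: "U \<in> ?I" for U
    by (rule hom_one[OF th[OF U] N.group_tensor_at'[OF U] N'.group_tensor_at'[OF U]])
  have f: "?f \<in> hom (tensor_sum G F M N) (tensor_sum G F M N')"
  proof (rule homI)
    fix s assume s: "s \<in> carrier (tensor_sum G F M N)"
    then have s1: "\<And>U. U \<in> ?I \<Longrightarrow> s U \<in> carrier (N.tensor_at U)"
      and s2: "finite {U \<in> ?I. s U \<noteq> \<one>\<^bsub>N.tensor_at U\<^esub>}"
      by (auto simp: tensor_sum_def carrier_sum_group N.group_tensor_at')
    have "finite {U \<in> ?I. ?f s U \<noteq> \<one>\<^bsub>N'.tensor_at U\<^esub>}"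
      by (rule finite_subset[OF _ s2]) (auto simp: tone)
    then show "?f s \<in> carrier (tensor_sum G F M N')"
      using s1 hom_in_carrier[OF th] by (auto simp: tensor_sum_def carrier_sum_group N'.group_tensor_at')
    fix t assume t: "t \<in> carrier (tensor_sum G F M N)"
    then have t1: "\<And>U. U \<in> ?I \<Longrightarrow> t U \<in> carrier (N.tensor_at U)"
      by (auto simp: tensor_sum_def carrier_sum_group N.group_tensor_at')
    show "?f (s \<otimes>\<^bsub>tensor_sum G F M N\<^esub> t) = ?f s \<otimes>\<^bsub>tensor_sum G F M N'\<^esub> ?f t"
      using s1 t1 by (auto simp: tensor_sum_def fun_eq_iff hom_mult[OF th])
  qed
  have fs: "?f (summand_tensor G F M N U m n) = summand_tensor G F M N' U m (\<eta> U n)"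
    if "U \<in> ?I" "m \<in> carrier (mval M U)" "n \<in> carrier (mval N U)" for U m n
    using that by (auto simp: summand_tensor_def fun_eq_iff tp tone)
  interpret f: group_hom "tensor_sum G F M N" "tensor_sum G F M N'" ?f
    using f by (simp add: group_hom_def group_hom_axioms_def)
  have "?f ` balancing_relations G F M N \<subseteq> balancing_relations G F M N'"
  proof (rule image_subsetI)
    fix z assume "z \<in> balancing_relations G F M N"
    then obtain U V \<phi> m n where z: "U \<in> ?I" "V \<in> ?I" "\<phi> \<in> orbit_hom G U V"
      "m \<in> carrier (mval M V)" "n \<in> carrier (mval N U)"
      "z = summand_tensor G F M N U (mact M U V \<phi> m) n \<otimes>\<^bsub>tensor_sum G F M N\<^esub>
        inv\<^bsub>tensor_sum G F M N\<^esub> summand_tensor G F M N V m (mact N U V \<phi> n)"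
      unfolding balancing_relations_def by blast
    have "?f z = ?f (summand_tensor G F M N U (mact M U V \<phi> m) n) \<otimes>\<^bsub>tensor_sum G F M N'\<^esub>
        inv\<^bsub>tensor_sum G F M N'\<^esub> ?f (summand_tensor G F M N V m (mact N U V \<phi> n))"
      unfolding z(6) using z N.summand_tensor_closed N.left_act_closed N.right_act_closed
      by (simp only: f.hom_mult f.hom_inv N.S.inv_closed)
    also have "\<dots> = summand_tensor G F M N' U (mact M U V \<phi> m) (\<eta> U n) \<otimes>\<^bsub>tensor_sum G F M N'\<^esub>
        inv\<^bsub>tensor_sum G F M N'\<^esub> summand_tensor G F M N' V m (mact N' U V \<phi> (\<eta> U n))"
      using z by (simp only: fs \<eta>n N.left_act_closed N.right_act_closed)
    finally show "?f z \<in> balancing_relations G F M N'"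
      unfolding balancing_relations_def using z \<eta>c by blast
  qed
  then have "?f ` balancing_relations G F M N \<subseteq> balancing_kernel G F M N'"
    by (auto simp: balancing_kernel_def intro: generate.incl)
  then have k: "?f ` balancing_kernel G F M N \<subseteq> balancing_kernel G F M N'"
    unfolding balancing_kernel_def[of G F M N]
    by (intro hom_image_generate_subset[OF N.S.is_group N'.S.is_group f] N.balancing_relations_subset N'.balancing_kernel_subgroup)
  note facts = N.S.comm_group_axioms N'.S.comm_group_axioms f N.balancing_kernel_subgroup N'.balancing_kernel_subgroup k
  show ?t1 unfolding module_tensor_map_def module_tensor_def by (rule quotient_map_hom[OF facts])
  show "PROP ?t2 U m n" for U m n
    unfolding module_tensor_map_def N.class_tensor_def N'.class_tensor_def
    by (subst quotient_map_rcoset[OF facts]) (simp_all only: fs N.summand_tensor_closed)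
qed

section \<open>The constant module\<close>

lemma right_module_constant_Z: "right_module G F constant_Z_module"
  by (auto simp: right_module_def constant_Z_module_def abelian_integer_group hom_def)

locale constant_tensor =
  fixes G :: "('a, 'b) monoid_scheme" and F :: "'a set set" and N :: "('a, 'n) orbit_module"
  assumes left: "left_module G F N"
begin

sublocale module_pair G F constant_Z_module N
  using right_module_constant_Z left by (simp add: module_pair_def)

text \<open>The structure map from the value of \<open>N\<close> at \<open>U\<close> into the
  colimit of \<open>N\<close>, sending n to 1 \<otimes> n.\<close>

definition unit_class where "unit_class U n = class_tensor U (1::int) n"

lemma comm_group_at: "U \<in> orbit_objects G F \<Longrightarrow> comm_group (mval N U)"
  using left by (simp add: left_module_def)

lemma act_hom:
  "\<lbrakk>U \<in> orbit_objects G F; V \<in> orbit_objects G F; \<phi> \<in> orbit_hom G U V\<rbrakk>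
    \<Longrightarrow> mact N U V \<phi> \<in> hom (mval N U) (mval N V)"
  using left by (simp add: left_module_def)

lemma act_compose:
  "\<lbrakk>U \<in> orbit_objects G F; V \<in> orbit_objects G F; W \<in> orbit_objects G F;
    \<phi> \<in> orbit_hom G U V; \<psi> \<in> orbit_hom G V W; n \<in> carrier (mval N U)\<rbrakk>
    \<Longrightarrow> mact N V W \<psi> (mact N U V \<phi> n) = mact N U W (compose U \<psi> \<phi>) n"
  using left by (simp add: left_module_def)

lemma carrier_constant_Z [simp]: "carrier (mval constant_Z_module U) = UNIV"
  and mult_constant_Z [simp]: "m \<otimes>\<^bsub>mval constant_Z_module U\<^esub> m' = m + m'"
  and act_constant_Z [simp]: "mact constant_Z_module U V \<phi> m = m"
  by (simp_all add: constant_Z_module_def)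

lemma unit_class_closed:
  "\<lbrakk>U \<in> orbit_objects G F; n \<in> carrier (mval N U)\<rbrakk> \<Longrightarrow> unit_class U n \<in> carrier (module_tensor G F constant_Z_module N)"
  by (simp add: unit_class_def class_tensor_closed)

lemma unit_class_hom:
  "U \<in> orbit_objects G F \<Longrightarrow> unit_class U \<in> hom (mval N U) (module_tensor G F constant_Z_module N)"
  by (rule homI) (simp_all add: unit_class_def class_tensor_closed class_tensor_mult_right)

lemma unit_class_act:
  assumes "U \<in> orbit_objects G F" "V \<in> orbit_objects G F" "\<phi> \<in> orbit_hom G U V" "n \<in> carrier (mval N U)"
  shows "unit_class V (mact N U V \<phi> n) = unit_class U n"
  using class_tensor_balanced[OF assms(1-3) _ assms(4), of 1] by (simp add: unit_class_def)

text \<open>For fixed n the assignment of m \<otimes> n to m is a homomorphism from the integers,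
  hence determined by its value at 1. Multiples appear as powers because the target is written
  multiplicatively.\<close>

lemma class_tensor_eq_pow:
  assumes U: "U \<in> orbit_objects G F" and n: "n \<in> carrier (mval N U)"
  shows "class_tensor U m n = unit_class U n [^]\<^bsub>module_tensor G F constant_Z_module N\<^esub> m"
proof -
  have "(\<lambda>m. class_tensor U m n) \<in> hom integer_group (module_tensor G F constant_Z_module N)"
    using U n class_tensor_mult_left[OF U _ _ n] by (auto intro!: homI class_tensor_closed)
  then interpret group_hom integer_group "module_tensor G F constant_Z_module N" "\<lambda>m. class_tensor U m n"
    by (simp add: group_hom_def group_hom_axioms_def T.is_group)
  show ?thesis using hom_int_pow[of 1 m] by (simp add: unit_class_def)
qed

lemma constant_tensor_generated:
  assumes Z: "subgroup Z (module_tensor G F constant_Z_module N)"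
    and "\<And>U n. \<lbrakk>U \<in> orbit_objects G F; n \<in> carrier (mval N U)\<rbrakk> \<Longrightarrow> unit_class U n \<in> Z"
  shows "Z = carrier (module_tensor G F constant_Z_module N)"
  by (rule module_tensor_generated[OF Z])
     (use assms T.subgroup_int_pow_closed[OF Z] in \<open>simp add: class_tensor_eq_pow\<close>)

text \<open>The family \<open>f\<close> is a cocone on \<open>N\<close>, and this is the universal
  property of the colimit. The value on m \<otimes> n has to be the \<open>m\<close>-th power of
  \<open>f U n\<close>; it is bilinear as \<open>C\<close> is commutative, and balanced as morphisms
  act trivially on the integers.\<close>

lemma constant_tensor_universal:
  assumes "comm_group C"
    and f: "\<And>U. U \<in> orbit_objects G F \<Longrightarrow> f U \<in> hom (mval N U) C"
    and bal: "\<And>U V \<phi> n. \<lbrakk>U \<in> orbit_objects G F; V \<in> orbit_objects G F; \<phi> \<in> orbit_hom G U V;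
      n \<in> carrier (mval N U)\<rbrakk> \<Longrightarrow> f V (mact N U V \<phi> n) = f U n"
  obtains h where "h \<in> hom (module_tensor G F constant_Z_module N) C"
    "\<And>U n. \<lbrakk>U \<in> orbit_objects G F; n \<in> carrier (mval N U)\<rbrakk> \<Longrightarrow> h (unit_class U n) = f U n"
proof -
  interpret C: comm_group C by fact
  have fc: "f U n \<in> carrier C" if "U \<in> orbit_objects G F" "n \<in> carrier (mval N U)" for U n
    using hom_in_carrier[OF f] that by blast
  have "\<exists>h. h \<in> hom (module_tensor G F constant_Z_module N) C \<and>
    (\<forall>U\<in>orbit_objects G F. \<forall>m. \<forall>n\<in>carrier (mval N U). h (class_tensor U m n) = f U n [^]\<^bsub>C\<^esub> m)"
    by (rule module_tensor_universal[where f = "\<lambda>U m n. f U n [^]\<^bsub>C\<^esub> m", OF assms(1)])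
       (auto simp: fc C.int_pow_mult hom_mult[OF f] C.int_pow_distrib bal)
  then obtain h where h: "h \<in> hom (module_tensor G F constant_Z_module N) C \<and>
    (\<forall>U\<in>orbit_objects G F. \<forall>m. \<forall>n\<in>carrier (mval N U). h (class_tensor U m n) = f U n [^]\<^bsub>C\<^esub> m)" ..
  show thesis
    by (rule that[of h]) (simp_all add: unit_class_def h fc)
qed

end

lemma constant_tensor_map:
  assumes N: "left_module G F N" and N': "left_module G F N'"
    and \<eta>: "\<eta> \<in> left_module_hom G F N N'" and "U \<in> orbit_objects G F" "n \<in> carrier (mval N U)"
  shows "module_tensor_map G F constant_Z_module N' \<eta> (constant_tensor.unit_class G F N U n) =
    constant_tensor.unit_class G F N' U (\<eta> U n)"
proof -
  interpret N: constant_tensor G F N by standard fact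
  interpret N': constant_tensor G F N' by standard fact
  show ?thesis unfolding N.unit_class_def N'.unit_class_def
    by (rule module_tensor_map_class[OF right_module_constant_Z N N' \<eta>]) (use assms in simp_all)
qed

section \<open>Directed families of subgroups\<close>

text \<open>For H \<subseteq> L the set product of aH and L is aL, so the projection from G/H to G/L
  is written without choosing representatives.\<close>

definition orbit_proj :: "('a, 'b) monoid_scheme \<Rightarrow> 'a set \<Rightarrow> 'a set \<Rightarrow> 'a set \<Rightarrow> 'a set" where
  "orbit_proj G H L = (\<lambda>A\<in>lcosets\<^bsub>G\<^esub> H. A <#>\<^bsub>G\<^esub> L)"

text \<open>Modules are indexed by orbits, directedness concerns subgroups. This recovers H from G/H
  as its only coset containing the unit, so that data indexed by subgroups can be read as data
  indexed by objects.\<close>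

definition base_subgroup :: "('a, 'b) monoid_scheme \<Rightarrow> 'a set set \<Rightarrow> 'a set" where
  "base_subgroup G U = (THE H. H \<in> U \<and> \<one>\<^bsub>G\<^esub> \<in> H)"

section \<open>Coset spaces and canonical projections between them\<close>

context group
begin

lemma lcosetsI: "a \<in> carrier G \<Longrightarrow> a <# H \<in> lcosets H"
  by (auto simp: LCOSETS_def)

lemma lcosetsE: "\<lbrakk>A \<in> lcosets H; \<And>a. \<lbrakk>a \<in> carrier G; A = a <# H\<rbrakk> \<Longrightarrow> thesis\<rbrakk> \<Longrightarrow> thesis"
  by (auto simp: LCOSETS_def)

lemma one_lcoset: "subgroup H G \<Longrightarrow> \<one> <# H = H"
  by (simp add: lcos_mult_one subgroup.subset)

lemma subgroup_in_lcosets: "subgroup H G \<Longrightarrow> H \<in> lcosets H"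
  using lcosetsI[of \<one> H] by (simp add: one_lcoset)

lemma lcoset_eq_iff:
  assumes "subgroup H G" "a \<in> carrier G" "b \<in> carrier G"
  shows "a <# H = b <# H \<longleftrightarrow> inv a \<otimes> b \<in> H"
proof
  assume "a <# H = b <# H"
  then have "b \<in> a <# H" using lcos_self[OF assms(3,1)] by simp
  then obtain h where "h \<in> H" "b = a \<otimes> h" unfolding l_coset_def by auto
  then show "inv a \<otimes> b \<in> H" using assms subgroup.mem_carrier[OF assms(1)] by (simp flip: m_assoc)
next
  assume h: "inv a \<otimes> b \<in> H"
  have "b = a \<otimes> (inv a \<otimes> b)" using assms by (simp flip: m_assoc)
  then have "b \<in> a <# H" using h unfolding l_coset_def by auto
  then show "a <# H = b <# H" using l_repr_independence[OF _ assms(2,1)] by simp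
qed

lemma base_subgroup_lcosets:
  assumes "subgroup H G" shows "base_subgroup G (lcosets H) = H"
  unfolding base_subgroup_def
proof (rule the_equality)
  show "H \<in> lcosets H \<and> \<one> \<in> H" using assms subgroup_in_lcosets subgroup.one_closed by blast
  fix A assume "A \<in> lcosets H \<and> \<one> \<in> A"
  then obtain a where a: "a \<in> carrier G" "A = a <# H" "\<one> \<in> a <# H" by (auto elim: lcosetsE)
  then show "A = H" using l_repr_independence[OF a(3) a(1) assms] one_lcoset[OF assms] by simp
qed

lemma lcoset_set_mult:
  assumes "subgroup H G" "subgroup L G" "H \<subseteq> L" "a \<in> carrier G"
  shows "(a <# H) <#> L = a <# L"
proof -
  have "H <#> L = L"
  proof
    show "H <#> L \<subseteq> L" using assms subgroup.m_closed[OF assms(2)] unfolding set_mult_def by blast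
    show "L \<subseteq> H <#> L"
      using subgroup.one_closed[OF assms(1)] subgroup.mem_carrier[OF assms(2)] l_one
      unfolding set_mult_def by force
  qed
  then show ?thesis
    using assms set_mult_assoc[of "{a}" H L] by (simp add: l_coset_eq_set_mult subgroup.subset)
qed

lemma orbit_proj_lcoset:
  assumes "subgroup H G" "subgroup L G" "H \<subseteq> L" "a \<in> carrier G"
  shows "orbit_proj G H L (a <# H) = a <# L"
  using assms by (simp add: orbit_proj_def lcosetsI lcoset_set_mult)

lemma orbit_proj_hom:
  assumes "subgroup H G" "subgroup L G" "H \<subseteq> L"
  shows "orbit_proj G H L \<in> orbit_hom G (lcosets H) (lcosets L)"
proof -
  have "orbit_proj G H L A \<in> lcosets L" if "A \<in> lcosets H" for A
    using that by (auto elim!: lcosetsE simp: orbit_proj_lcoset[OF assms] lcosetsI)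
  moreover have "orbit_proj G H L (g <# A) = g <# orbit_proj G H L A"
    if "g \<in> carrier G" "A \<in> lcosets H" for g A
    using that assms
    by (auto elim!: lcosetsE simp: orbit_proj_lcoset[OF assms] lcos_m_assoc subgroup.subset)
  ultimately show ?thesis by (auto simp: orbit_hom_def orbit_proj_def)
qed

lemma orbit_hom_lcoset:
  assumes "\<phi> \<in> orbit_hom G (lcosets H) V" "subgroup H G" "g \<in> carrier G"
  shows "\<phi> (g <# H) = g <# \<phi> H"
  using assms subgroup_in_lcosets by (auto simp: orbit_hom_def)

lemma orbit_proj_id: "subgroup H G \<Longrightarrow> orbit_proj G H H = (\<lambda>A\<in>lcosets H. A)"
  unfolding orbit_proj_def by (rule restrict_ext) (auto elim!: lcosetsE simp: lcoset_set_mult)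

text \<open>Each h in H fixes the coset H, hence by equivariance also aK; so H lies in
  aKa\<inverse>, which lies in L because K and a do. The composite sends gH to gaL, which is gL
  since a is in L.\<close>

lemma orbit_proj_compose:
  assumes H: "subgroup H G" and K: "subgroup K G" and L: "subgroup L G" and KL: "K \<subseteq> L"
    and \<phi>: "\<phi> \<in> orbit_hom G (lcosets H) (lcosets K)" and a: "\<phi> H = a <# K" "a \<in> L"
  shows "H \<subseteq> L" "compose (lcosets H) (orbit_proj G K L) \<phi> = orbit_proj G H L"
proof -
  have ac: "a \<in> carrier G" using subgroup.mem_carrier[OF L a(2)] .
  show HL: "H \<subseteq> L"
  proof
    fix h assume h: "h \<in> H"
    then have hc: "h \<in> carrier G" using subgroup.mem_carrier[OF H] by blast
    have "h <# H = H" using h H hc coset_join3 by blast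
    then have "h <# (a <# K) = a <# K" using orbit_hom_lcoset[OF \<phi> H hc] a by simp
    then have "(h \<otimes> a) <# K = a <# K" using hc ac K by (simp add: lcos_m_assoc subgroup.subset)
    then have "h \<otimes> a \<in> a <# K" using lcos_self[of "h \<otimes> a" K] hc ac K by auto
    then obtain k where k: "k \<in> K" "h \<otimes> a = a \<otimes> k" unfolding l_coset_def by auto
    then have "h = a \<otimes> k \<otimes> inv a" using hc ac subgroup.mem_carrier[OF K] by (metis inv_solve_right m_closed)
    then show "h \<in> L" using k KL a(2) L by (simp add: subgroup.m_closed subgroup.m_inv_closed subsetD)
  qed
  show "compose (lcosets H) (orbit_proj G K L) \<phi> = orbit_proj G H L"
  proof (rule extensionalityI[of _ "lcosets H"])
    fix A assume "A \<in> lcosets H"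
    then obtain g where g: "g \<in> carrier G" "A = g <# H" by (rule lcosetsE)
    have "orbit_proj G K L (\<phi> A) = orbit_proj G K L ((g \<otimes> a) <# K)"
      using g ac a orbit_hom_lcoset[OF \<phi> H] K by (simp add: lcos_m_assoc subgroup.subset)
    also have "\<dots> = (g \<otimes> a) <# L" using g ac orbit_proj_lcoset[OF K L KL] by simp
    also have "\<dots> = g <# L"
      using g ac a coset_join3[OF ac L] L by (simp add: lcos_m_assoc[symmetric] subgroup.subset)
    finally show "compose (lcosets H) (orbit_proj G K L) \<phi> A = orbit_proj G H L A"
      using g \<open>A \<in> lcosets H\<close> orbit_proj_lcoset[OF H L HL] by (simp add: compose_def)
  qed (auto simp: orbit_proj_def)
qed

end

section \<open>Orbits for a family of subgroups, and directed families\<close>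

locale subgroup_family = group G for G :: "('a, 'b) monoid_scheme" (structure) +
  fixes F :: "'a set set"
  assumes F_subgroup: "H \<in> F \<Longrightarrow> subgroup H G"
begin

lemma objI: "H \<in> F \<Longrightarrow> lcosets H \<in> orbit_objects G F"
  by (simp add: orbit_objects_def)

lemma objE: "\<lbrakk>U \<in> orbit_objects G F; \<And>H. \<lbrakk>H \<in> F; U = lcosets H\<rbrakk> \<Longrightarrow> thesis\<rbrakk> \<Longrightarrow> thesis"
  by (auto simp: orbit_objects_def)

lemma proj_hom:
  "\<lbrakk>H \<in> F; L \<in> F; H \<subseteq> L\<rbrakk> \<Longrightarrow> orbit_proj G H L \<in> orbit_hom G (lcosets H) (lcosets L)"
  by (simp add: orbit_proj_hom F_subgroup)

lemma orbit_id_hom: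
  assumes "U \<in> orbit_objects G F" shows "(\<lambda>A\<in>U. A) \<in> orbit_hom G U U"
  using assms proj_hom by (auto elim!: objE simp flip: orbit_proj_id[OF F_subgroup])

lemma orbit_subset: "\<lbrakk>U \<in> orbit_objects G F; A \<in> U\<rbrakk> \<Longrightarrow> A \<subseteq> carrier G"
  using F_subgroup by (auto elim!: objE dest: subgroup.lcosets_carrier[OF _ is_group])

lemma orbit_translate:
  assumes "U \<in> orbit_objects G F" "g \<in> carrier G" "A \<in> U" shows "g <# A \<in> U"
  using assms F_subgroup
  by (auto elim!: objE lcosetsE simp: lcos_m_assoc subgroup.subset lcosetsI)

lemma orbit_hom_compose:
  assumes U: "U \<in> orbit_objects G F" and "\<phi> \<in> orbit_hom G U V" "\<psi> \<in> orbit_hom G V W"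
  shows "compose U \<psi> \<phi> \<in> orbit_hom G U W"
  using assms(2,3) orbit_translate[OF U] by (auto simp: orbit_hom_def compose_def PiE_iff)

end

text \<open>The element \<open>a\<close> is the one by which a morphism displaces the base coset;
  having it in \<open>L\<close> lets the projection to G/L absorb that displacement. With
  \<open>a\<close> the unit the condition is directedness under inclusion.\<close>

locale directed_family = subgroup_family +
  assumes F_nonempty: "F \<noteq> {}"
    and F_directed: "\<lbrakk>H \<in> F; K \<in> F; a \<in> carrier G\<rbrakk> \<Longrightarrow> \<exists>L\<in>F. H \<subseteq> L \<and> K \<subseteq> L \<and> a \<in> L"

locale directed_constant_tensor = directed_family G F + constant_tensor G F N
  for G :: "('a, 'b) monoid_scheme" (structure) and F N
begin

abbreviation "transport H L \<equiv> mact N (lcosets H) (lcosets L) (orbit_proj G H L)"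

lemma transport_hom:
  "\<lbrakk>H \<in> F; L \<in> F; H \<subseteq> L\<rbrakk> \<Longrightarrow> transport H L \<in> hom (mval N (lcosets H)) (mval N (lcosets L))"
  by (simp add: act_hom objI proj_hom)

lemma transport_closed:
  "\<lbrakk>H \<in> F; L \<in> F; H \<subseteq> L; n \<in> carrier (mval N (lcosets H))\<rbrakk> \<Longrightarrow> transport H L n \<in> carrier (mval N (lcosets L))"
  using hom_in_carrier[OF transport_hom] .

lemma unit_class_transport:
  "\<lbrakk>H \<in> F; L \<in> F; H \<subseteq> L; n \<in> carrier (mval N (lcosets H))\<rbrakk>
    \<Longrightarrow> unit_class (lcosets L) (transport H L n) = unit_class (lcosets H) n"
  by (simp add: unit_class_act objI proj_hom)

definition eventually_one where
  "eventually_one = {f \<in> carrier (product_group F (\<lambda>L. mval N (lcosets L))).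
     \<exists>L0\<in>F. \<forall>L\<in>F. L0 \<subseteq> L \<longrightarrow> f L = \<one>\<^bsub>mval N (lcosets L)\<^esub>}"

lemma comm_group_at': "L \<in> F \<Longrightarrow> comm_group (mval N (lcosets L))"
  by (simp add: comm_group_at objI)

lemma group_at': "L \<in> F \<Longrightarrow> Group.group (mval N (lcosets L))"
  by (simp add: comm_group_at' comm_group.axioms(2))

lemma comm_group_prod: "comm_group (product_group F (\<lambda>L. mval N (lcosets L)))"
  by (rule comm_group_product_group[OF comm_group_at'])

lemma eventually_one_subgroup: "subgroup eventually_one (product_group F (\<lambda>L. mval N (lcosets L)))"
proof -
  interpret P: comm_group "product_group F (\<lambda>L. mval N (lcosets L))" by (rule comm_group_prod)
  show ?thesis
  proof
    show "eventually_one \<subseteq> carrier (product_group F (\<lambda>L. mval N (lcosets L)))"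
      by (auto simp: eventually_one_def)
    show "\<one>\<^bsub>product_group F (\<lambda>L. mval N (lcosets L))\<^esub> \<in> eventually_one"
      using P.one_closed F_nonempty by (auto simp: eventually_one_def)
    fix x assume x: "x \<in> eventually_one"
    then obtain L1 where L1: "L1 \<in> F" "\<forall>L\<in>F. L1 \<subseteq> L \<longrightarrow> x L = \<one>\<^bsub>mval N (lcosets L)\<^esub>"
      unfolding eventually_one_def by blast
    have xc: "x \<in> carrier (product_group F (\<lambda>L. mval N (lcosets L)))"
      using x by (simp add: eventually_one_def)
    have "(inv\<^bsub>product_group F (\<lambda>L. mval N (lcosets L))\<^esub> x) L = \<one>\<^bsub>mval N (lcosets L)\<^esub>"
      if "L \<in> F" "L1 \<subseteq> L" for L
      using that L1 xc group_at' monoid.inv_one[OF group.is_monoid[OF group_at']] by simp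
    then show "inv\<^bsub>product_group F (\<lambda>L. mval N (lcosets L))\<^esub> x \<in> eventually_one"
      using L1 P.inv_closed[OF xc] unfolding eventually_one_def by blast
    fix y assume y: "y \<in> eventually_one"
    then obtain L2 where L2: "L2 \<in> F" "\<forall>L\<in>F. L2 \<subseteq> L \<longrightarrow> y L = \<one>\<^bsub>mval N (lcosets L)\<^esub>"
      unfolding eventually_one_def by blast
    obtain L0 where L0: "L0 \<in> F" "L1 \<subseteq> L0" "L2 \<subseteq> L0" using F_directed[OF L1(1) L2(1) one_closed] by blast
    have yc: "y \<in> carrier (product_group F (\<lambda>L. mval N (lcosets L)))"
      using y by (simp add: eventually_one_def)
    have "(x \<otimes>\<^bsub>product_group F (\<lambda>L. mval N (lcosets L))\<^esub> y) L = \<one>\<^bsub>mval N (lcosets L)\<^esub>"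
      if L: "L \<in> F" "L0 \<subseteq> L" for L
    proof -
      have "x L = \<one>\<^bsub>mval N (lcosets L)\<^esub>" "y L = \<one>\<^bsub>mval N (lcosets L)\<^esub>" using L L0 L1 L2 by auto
      then show ?thesis using L group.is_monoid[OF group_at'] by simp
    qed
    then show "x \<otimes>\<^bsub>product_group F (\<lambda>L. mval N (lcosets L))\<^esub> y \<in> eventually_one"
      using L0(1) P.m_closed[OF xc yc] unfolding eventually_one_def by blast
  qed
qed

text \<open>The reduced product of the groups \<open>N (G/L)\<close> modulo eventual triviality receives the directed
  colimit of \<open>N\<close> and detects which elements die in it, without constructing that colimit.\<close>

lemma unit_class_eq_oneD:
  assumes H: "H \<in> F" and n: "n \<in> carrier (mval N (lcosets H))"
    and one: "unit_class (lcosets H) n = \<one>\<^bsub>module_tensor G F constant_Z_module N\<^esub>"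
  shows "\<exists>L\<in>F. H \<subseteq> L \<and> transport H L n = \<one>\<^bsub>mval N (lcosets L)\<^esub>"
proof -
  let ?P = "product_group F (\<lambda>L. mval N (lcosets L))"
  interpret P: comm_group ?P by (rule comm_group_prod)
  interpret E: normal eventually_one ?P by (rule P.subgroup_imp_normal[OF eventually_one_subgroup])
  have Q: "comm_group (?P Mod eventually_one)" by (rule P.abelian_FactGroup[OF eventually_one_subgroup])
  \<comment> \<open>The family of all transports of \<open>k\<close> to larger subgroups. The
    default value at subgroups not containing \<open>K\<close> is harmless, as only large subgroups
    matter modulo \<open>eventually_one\<close>.\<close>
  define t where "t K k = (\<lambda>L\<in>F. if K \<subseteq> L then transport K L k else \<one>\<^bsub>mval N (lcosets L)\<^esub>)" for K k
  have tc: "t K k \<in> carrier ?P" if "K \<in> F" "k \<in> carrier (mval N (lcosets K))" for K k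
    using that transport_closed group.is_monoid[OF group_at'] by (auto simp: t_def)
  have th: "t K \<in> hom (mval N (lcosets K)) ?P" if K: "K \<in> F" for K
    using K by (intro homI tc)
      (auto simp: t_def fun_eq_iff hom_mult[OF transport_hom] group.is_monoid[OF group_at'])
  define f where "f U k = eventually_one #>\<^bsub>?P\<^esub> t (base_subgroup G U) k" for U k
  have f: "f (lcosets K) = (\<lambda>k. eventually_one #>\<^bsub>?P\<^esub> t K k)" if "K \<in> F" for K
    using that by (simp add: f_def fun_eq_iff base_subgroup_lcosets F_subgroup)
  have fh: "f U \<in> hom (mval N U) (?P Mod eventually_one)" if "U \<in> orbit_objects G F" for U
  proof -
    obtain K where K: "K \<in> F" "U = lcosets K" using \<open>U \<in> _\<close> by (rule objE)
    show ?thesis unfolding K(2) f[OF K(1)]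
      using Group.hom_compose[OF th[OF K(1)] E.r_coset_hom_Mod] by (simp add: comp_def)
  qed
  have bal: "f V (mact N U V \<phi> k) = f U k"
    if U: "U \<in> orbit_objects G F" and V: "V \<in> orbit_objects G F" and \<phi>: "\<phi> \<in> orbit_hom G U V"
      and k: "k \<in> carrier (mval N U)" for U V \<phi> k
  proof -
    obtain H' where H': "H' \<in> F" "U = lcosets H'" using U by (rule objE)
    obtain K where K: "K \<in> F" "V = lcosets K" using V by (rule objE)
    have sub: "subgroup H' G" "subgroup K G" using H' K F_subgroup by auto
    have "\<phi> H' \<in> lcosets K" using \<phi> subgroup_in_lcosets[OF sub(1)] H' K by (auto simp: orbit_hom_def)
    then obtain a where a: "a \<in> carrier G" "\<phi> H' = a <# K" by (rule lcosetsE)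
    obtain L0 where L0: "L0 \<in> F" "K \<subseteq> L0" "a \<in> L0" using F_directed[OF K(1) K(1) a(1)] by blast
    let ?k = "mact N U V \<phi> k"
    have kc: "?k \<in> carrier (mval N V)" using left_act_closed U V \<phi> k by blast
    have c: "t K ?k \<in> carrier ?P" "t H' k \<in> carrier ?P" using tc H' K k kc by auto
    \<comment> \<open>Above \<open>L0\<close> the morphism followed by the projection to G/L is
      itself a projection, so the two families agree there, although they may differ at smaller
      subgroups.\<close>
    have eq: "t K ?k L = t H' k L" if L: "L \<in> F" "L0 \<subseteq> L" for L
    proof -
      have KL: "K \<subseteq> L" and aL: "a \<in> L" using L L0 by auto
      note pc = orbit_proj_compose[OF sub F_subgroup[OF L(1)] KL \<phi>[unfolded H'(2) K(2)] a(2) aL]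
      have "transport K L ?k = transport H' L k"
        using act_compose[OF U V objI[OF L(1)] \<phi> proj_hom[OF K(1) L(1) KL, folded K(2)] k] pc(2) H' K by simp
      then show ?thesis using L KL pc(1) by (simp add: t_def)
    qed
    have "t K ?k \<otimes>\<^bsub>?P\<^esub> inv\<^bsub>?P\<^esub> t H' k \<in> eventually_one"
      unfolding eventually_one_def
    proof (intro CollectI conjI bexI[OF _ L0(1)] ballI impI)
      show "t K ?k \<otimes>\<^bsub>?P\<^esub> inv\<^bsub>?P\<^esub> t H' k \<in> carrier ?P" using c by blast
      fix L assume L: "L \<in> F" "L0 \<subseteq> L"
      have "t H' k L \<in> carrier (mval N (lcosets L))" using c(2) L by auto
      then show "(t K ?k \<otimes>\<^bsub>?P\<^esub> inv\<^bsub>?P\<^esub> t H' k) L = \<one>\<^bsub>mval N (lcosets L)\<^esub>"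
        using L c eq[OF L] group_at' by (simp add: group.r_inv)
    qed
    then have "t K ?k \<in> eventually_one #>\<^bsub>?P\<^esub> t H' k"
      using E.rcos_module[OF P.is_group c(2,1)] by blast
    then show ?thesis unfolding K(2) H'(2) f[OF K(1)] f[OF H'(1)]
      using P.repr_independence[OF _ c(2) eventually_one_subgroup] K H' by simp
  qed
  obtain h where h: "h \<in> hom (module_tensor G F constant_Z_module N) (?P Mod eventually_one)"
    "\<And>U n. \<lbrakk>U \<in> orbit_objects G F; n \<in> carrier (mval N U)\<rbrakk> \<Longrightarrow> h (unit_class U n) = f U n"
    using constant_tensor_universal[OF Q fh bal] by blast
  have "f (lcosets H) n = \<one>\<^bsub>?P Mod eventually_one\<^esub>"
    using h(2)[OF objI[OF H] n] one hom_one[OF h(1) T.is_group comm_group.axioms(2)[OF Q]] by simp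
  then have "eventually_one #>\<^bsub>?P\<^esub> t H n = eventually_one" using f[OF H] by simp
  then have "t H n \<in> eventually_one"
    using P.coset_join1[OF _ tc[OF H n] eventually_one_subgroup] by blast
  then obtain L0 where L0: "L0 \<in> F" "\<And>L. \<lbrakk>L \<in> F; L0 \<subseteq> L\<rbrakk> \<Longrightarrow> t H n L = \<one>\<^bsub>mval N (lcosets L)\<^esub>"
    unfolding eventually_one_def by blast
  \<comment> \<open>Only above \<open>H\<close> is the entry of \<open>t H n\<close> a transport
    rather than the default value, so \<open>L\<close> is taken above \<open>H\<close> as well as
    above \<open>L0\<close>.\<close>
  obtain L where L: "L \<in> F" "H \<subseteq> L" "L0 \<subseteq> L" using F_directed[OF H L0(1) one_closed] by blast
  then show ?thesis using L0(2)[of L] by (auto simp: t_def)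
qed

text \<open>Two representatives can be transported to a common larger subgroup and multiplied there.
  Hence the classes coming from single objects already form a subgroup, and this subgroup contains
  all generators.\<close>

lemma constant_tensor_elementE:
  assumes "x \<in> carrier (module_tensor G F constant_Z_module N)"
  obtains H n where "H \<in> F" "n \<in> carrier (mval N (lcosets H))" "x = unit_class (lcosets H) n"
proof -
  let ?T = "module_tensor G F constant_Z_module N"
  let ?Z = "{unit_class (lcosets H) n | H n. H \<in> F \<and> n \<in> carrier (mval N (lcosets H))}"
  have uh: "group_hom (mval N (lcosets H)) ?T (unit_class (lcosets H))" if "H \<in> F" for H
    using that by (simp add: group_hom_def group_hom_axioms_def group_at' T.is_group unit_class_hom objI)
  have "subgroup ?Z ?T"
  proof
    show "?Z \<subseteq> carrier ?T" by (auto simp: unit_class_closed objI)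
    obtain H where H: "H \<in> F" using F_nonempty by blast
    show "\<one>\<^bsub>?T\<^esub> \<in> ?Z"
      using H group_hom.hom_one[OF uh[OF H]] group.is_monoid[OF group_at'[OF H]] 
      by (metis (mono_tags, lifting) mem_Collect_eq monoid.one_closed)
    fix x assume "x \<in> ?Z"
    then obtain H n where x: "H \<in> F" "n \<in> carrier (mval N (lcosets H))" "x = unit_class (lcosets H) n" by blast
    have "inv\<^bsub>?T\<^esub> x = unit_class (lcosets H) (inv\<^bsub>mval N (lcosets H)\<^esub> n)"
      using group_hom.hom_inv[OF uh] x by simp
    then show "inv\<^bsub>?T\<^esub> x \<in> ?Z" using x group.inv_closed[OF group_at'] by blast
    fix y assume "y \<in> ?Z"
    then obtain K k where y: "K \<in> F" "k \<in> carrier (mval N (lcosets K))" "y = unit_class (lcosets K) k" by blast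
    obtain L where L: "L \<in> F" "H \<subseteq> L" "K \<subseteq> L" using F_directed[OF x(1) y(1) one_closed] by blast
    let ?n = "transport H L n" and ?k = "transport K L k"
    have c: "?n \<in> carrier (mval N (lcosets L))" "?k \<in> carrier (mval N (lcosets L))"
      using transport_closed x y L by auto
    have "x = unit_class (lcosets L) ?n" "y = unit_class (lcosets L) ?k"
      using unit_class_transport x y L by auto
    then have "x \<otimes>\<^bsub>?T\<^esub> y = unit_class (lcosets L) (?n \<otimes>\<^bsub>mval N (lcosets L)\<^esub> ?k)"
      using group_hom.hom_mult[OF uh[OF L(1)] c] by simp
    then show "x \<otimes>\<^bsub>?T\<^esub> y \<in> ?Z"
      using L c monoid.m_closed[OF group.is_monoid[OF group_at']] by blast
  qed
  then have "?Z = carrier ?T"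
    by (rule constant_tensor_generated) (auto elim!: objE)
  then show thesis using assms that by blast
qed

end

text \<open>Exactness is chased on representatives: each element lives at a single object, and if
  its image vanishes in the tensor product, it vanishes after transport to some larger
  \<open>L\<close>. There the given sequence is exact, and transport has not changed the
  class.\<close>

lemma (in directed_family) flat_constant_Z:
  "flat_right_module TYPE('u) G F constant_Z_module"
  unfolding flat_right_module_def
proof (intro conjI allI impI)
  show "right_module G F constant_Z_module" by (rule right_module_constant_Z)
  fix N1 N2 N3 :: "('a, 'u) orbit_module" and \<eta> \<theta>
  assume ex: "module_short_exact G F N1 N2 N3 \<eta> \<theta>"
  then have N: "left_module G F N1" "left_module G F N2" "left_module G F N3"
    and \<eta>: "\<eta> \<in> left_module_hom G F N1 N2" and \<theta>: "\<theta> \<in> left_module_hom G F N2 N3"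
    and ses: "\<And>U. U \<in> orbit_objects G F \<Longrightarrow>
      short_exact_sequence (mval N3 U) (mval N2 U) (mval N1 U) (\<theta> U) (\<eta> U)"
    by (simp_all add: module_short_exact_def)
  interpret N1: directed_constant_tensor G F N1 by unfold_locales fact
  interpret N2: directed_constant_tensor G F N2 by unfold_locales fact
  interpret N3: directed_constant_tensor G F N3 by unfold_locales fact
  let ?T1 = "module_tensor G F constant_Z_module N1" and ?T2 = "module_tensor G F constant_Z_module N2"
    and ?T3 = "module_tensor G F constant_Z_module N3"
  let ?h = "module_tensor_map G F constant_Z_module N2 \<eta>" and ?t = "module_tensor_map G F constant_Z_module N3 \<theta>"
  note h = constant_tensor_map[OF N(1,2) \<eta>] and t = constant_tensor_map[OF N(2,3) \<theta>]
  note hh = module_tensor_map_hom[OF right_module_constant_Z N(1,2) \<eta>]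
    and th = module_tensor_map_hom[OF right_module_constant_Z N(2,3) \<theta>]
  have \<eta>c: "\<eta> (lcosets H) n \<in> carrier (mval N2 (lcosets H))"
    if "H \<in> F" "n \<in> carrier (mval N1 (lcosets H))" for H n
    using \<eta> that hom_in_carrier[of "\<eta> (lcosets H)"] objI by (fastforce simp: left_module_hom_def)
  have \<theta>c: "\<theta> (lcosets H) n \<in> carrier (mval N3 (lcosets H))"
    if "H \<in> F" "n \<in> carrier (mval N2 (lcosets H))" for H n
    using \<theta> that hom_in_carrier[of "\<theta> (lcosets H)"] objI by (fastforce simp: left_module_hom_def)
  have \<eta>t: "\<eta> (lcosets L) (N1.transport H L n) = N2.transport H L (\<eta> (lcosets H) n)"
    if "H \<in> F" "L \<in> F" "H \<subseteq> L" "n \<in> carrier (mval N1 (lcosets H))" for H L n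
    using \<eta> that objI proj_hom by (simp add: left_module_hom_def)
  have \<theta>t: "\<theta> (lcosets L) (N2.transport H L n) = N3.transport H L (\<theta> (lcosets H) n)"
    if "H \<in> F" "L \<in> F" "H \<subseteq> L" "n \<in> carrier (mval N2 (lcosets H))" for H L n
    using \<theta> that objI proj_hom by (simp add: left_module_hom_def)
  have surj: "\<theta> (lcosets H) ` carrier (mval N2 (lcosets H)) = carrier (mval N3 (lcosets H))"
    and inj: "inj_on (\<eta> (lcosets H)) (carrier (mval N1 (lcosets H)))"
    and ker: "kernel (mval N2 (lcosets H)) (mval N3 (lcosets H)) (\<theta> (lcosets H)) = \<eta> (lcosets H) ` carrier (mval N1 (lcosets H))"
    if "H \<in> F" for H
    using ses[OF objI[OF that]] by (auto simp: short_exact_sequence_iff epi_def mon_def)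
  have "x = \<one>\<^bsub>?T1\<^esub>" if x: "x \<in> carrier ?T1" "?h x = \<one>\<^bsub>?T2\<^esub>" for x
  proof -
    obtain H n where n: "H \<in> F" "n \<in> carrier (mval N1 (lcosets H))" "x = N1.unit_class (lcosets H) n"
      using x(1) by (rule N1.constant_tensor_elementE)
    then have "N2.unit_class (lcosets H) (\<eta> (lcosets H) n) = \<one>\<^bsub>?T2\<^esub>" using x h objI by simp
    then obtain L where L: "L \<in> F" "H \<subseteq> L" "N2.transport H L (\<eta> (lcosets H) n) = \<one>\<^bsub>mval N2 (lcosets L)\<^esub>"
      using N2.unit_class_eq_oneD n \<eta>c by blast
    have c: "N1.transport H L n \<in> carrier (mval N1 (lcosets L))" using N1.transport_closed n L by blast
    interpret e: group_hom "mval N1 (lcosets L)" "mval N2 (lcosets L)" "\<eta> (lcosets L)"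
      using \<eta> L objI N1.group_at' N2.group_at' by (simp add: left_module_hom_def group_hom_def group_hom_axioms_def)
    have "\<eta> (lcosets L) (N1.transport H L n) = \<one>\<^bsub>mval N2 (lcosets L)\<^esub>" using \<eta>t n L by simp
    then have "N1.transport H L n = \<one>\<^bsub>mval N1 (lcosets L)\<^esub>" using inj[OF L(1)] c e.inj_on_one_iff by blast
    then have "x = N1.unit_class (lcosets L) \<one>\<^bsub>mval N1 (lcosets L)\<^esub>"
      using N1.unit_class_transport[OF n(1) L(1,2) n(2)] n(3) by simp
    then show ?thesis
      using hom_one[OF N1.unit_class_hom[OF objI] N1.group_at' N1.T.is_group] L by simp
  qed
  then have mon: "?h \<in> mon ?T1 ?T2"
    using hh by (simp add: mon_iff_hom_one N1.T.is_group N2.T.is_group)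
  have "carrier ?T3 \<subseteq> ?t ` carrier ?T2"
  proof
    fix x assume "x \<in> carrier ?T3"
    then obtain H n where n: "H \<in> F" "n \<in> carrier (mval N3 (lcosets H))" "x = N3.unit_class (lcosets H) n"
      by (rule N3.constant_tensor_elementE)
    then obtain k where "k \<in> carrier (mval N2 (lcosets H))" "n = \<theta> (lcosets H) k" using surj by blast
    then show "x \<in> ?t ` carrier ?T2" using t n objI N2.unit_class_closed by (metis image_eqI)
  qed
  then have epi: "?t \<in> epi ?T2 ?T3" using th by (simp add: epi_iff_subset)
  have "kernel ?T2 ?T3 ?t = ?h ` carrier ?T1"
  proof
    show "?h ` carrier ?T1 \<subseteq> kernel ?T2 ?T3 ?t"
    proof (rule image_subsetI)
      fix x assume x: "x \<in> carrier ?T1"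
      then obtain H n where n: "H \<in> F" "n \<in> carrier (mval N1 (lcosets H))" "x = N1.unit_class (lcosets H) n"
        by (rule N1.constant_tensor_elementE)
      have "\<theta> (lcosets H) (\<eta> (lcosets H) n) = \<one>\<^bsub>mval N3 (lcosets H)\<^esub>"
        using ker[OF n(1)] n(2) by (auto simp: kernel_def)
      then have "?t (?h x) = \<one>\<^bsub>?T3\<^esub>"
        using h t n objI \<eta>c hom_one[OF N3.unit_class_hom[OF objI] N3.group_at' N3.T.is_group] by simp
      then show "?h x \<in> kernel ?T2 ?T3 ?t" using x hom_in_carrier[OF hh] by (simp add: kernel_def)
    qed
    \<comment> \<open>At \<open>H\<close> itself the image of \<open>n\<close> under
      \<open>\<theta>\<close> need not vanish; the preimage under \<open>\<eta>\<close> is available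
      only after transport to \<open>L\<close>.\<close>
    show "kernel ?T2 ?T3 ?t \<subseteq> ?h ` carrier ?T1"
    proof
      fix x assume x: "x \<in> kernel ?T2 ?T3 ?t"
      then have "x \<in> carrier ?T2" by (simp add: kernel_def)
      then obtain H n where n: "H \<in> F" "n \<in> carrier (mval N2 (lcosets H))" "x = N2.unit_class (lcosets H) n"
        by (rule N2.constant_tensor_elementE)
      have "N3.unit_class (lcosets H) (\<theta> (lcosets H) n) = \<one>\<^bsub>?T3\<^esub>"
        using x n t objI by (simp add: kernel_def)
      then obtain L where L: "L \<in> F" "H \<subseteq> L" "N3.transport H L (\<theta> (lcosets H) n) = \<one>\<^bsub>mval N3 (lcosets L)\<^esub>"
        using N3.unit_class_eq_oneD n \<theta>c by blast
      have "N2.transport H L n \<in> kernel (mval N2 (lcosets L)) (mval N3 (lcosets L)) (\<theta> (lcosets L))"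
        using \<theta>t[OF n(1) L(1,2) n(2)] L N2.transport_closed[OF n(1) L(1,2) n(2)] by (simp add: kernel_def)
      then obtain k where k: "k \<in> carrier (mval N1 (lcosets L))" "N2.transport H L n = \<eta> (lcosets L) k"
        using ker[OF L(1)] by blast
      have "x = N2.unit_class (lcosets L) (\<eta> (lcosets L) k)"
        using N2.unit_class_transport[OF n(1) L(1,2) n(2)] n(3) k(2) by simp
      also have "\<dots> = ?h (N1.unit_class (lcosets L) k)" using h k objI L by simp
      finally show "x \<in> ?h ` carrier ?T1" using N1.unit_class_closed k objI L by blast
    qed
  qed
  then show "short_exact_sequence ?T3 ?T2 ?T1 ?t ?h"
    using mon epi hh th N1.T.is_group N2.T.is_group N3.T.is_group
    by (simp add: short_exact_sequence_iff group_hom_def group_hom_axioms_def)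
qed

section \<open>Virtually cyclic subgroups\<close>

text \<open>On \<open>A\<close> the map \<open>g\<close> factors through \<open>f\<close>, so it
  takes no more values. The lemma serves to pass finiteness from one set of cosets to
  another.\<close>

lemma finite_image_factor:
  assumes "finite (f ` A)" "\<And>x y. \<lbrakk>x \<in> A; y \<in> A; f x = f y\<rbrakk> \<Longrightarrow> g x = g y"
  shows "finite (g ` A)"
proof -
  have "g ` A \<subseteq> (\<lambda>z. g (inv_into A f z)) ` f ` A"
  proof (rule image_subsetI)
    fix x assume x: "x \<in> A"
    then have "g (inv_into A f (f x)) = g x"
      by (intro assms(2)) (auto simp: inv_into_into f_inv_into_f)
    then show "g x \<in> (\<lambda>z. g (inv_into A f z)) ` f ` A" using x by (force simp: image_image)
  qed
  then show ?thesis using assms(1) finite_surj by blast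
qed

section \<open>Finite index and cyclic subgroups inside a fixed group\<close>

context group
begin

lemma generate_singleton_subgroup: "c \<in> carrier G \<Longrightarrow> subgroup (generate G {c}) G"
  by (rule generate_is_subgroup) simp

lemma inv_image_rcoset:
  assumes "subgroup C G" "h \<in> carrier G"
  shows "m_inv G ` (C #> h) = inv h <# C"
proof
  show "m_inv G ` (C #> h) \<subseteq> inv h <# C"
    using assms subgroup.m_inv_closed[OF assms(1)] subgroup.mem_carrier[OF assms(1)]
    by (auto simp: r_coset_def l_coset_def inv_mult_group)
  show "inv h <# C \<subseteq> m_inv G ` (C #> h)"
  proof
    fix x assume "x \<in> inv h <# C"
    then obtain c where c: "c \<in> C" "x = inv h \<otimes> c" by (auto simp: l_coset_def)
    then have "x = inv (inv c \<otimes> h)" using assms subgroup.mem_carrier[OF assms(1)] by (simp add: inv_mult_group)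
    then show "x \<in> m_inv G ` (C #> h)"
      using c subgroup.m_inv_closed[OF assms(1)] unfolding r_coset_def by blast
  qed
qed

lemma inv_image_lcoset:
  assumes "subgroup C G" "h \<in> carrier G"
  shows "m_inv G ` (inv h <# C) = C #> h"
proof -
  have "m_inv G ` m_inv G ` (C #> h) = C #> h"
    using r_coset_subset_G[OF subgroup.subset[OF assms(1)] assms(2)] by (force simp: image_image)
  then show ?thesis using inv_image_rcoset[OF assms] by simp
qed

text \<open>Inversion exchanges the right coset of \<open>h\<close> with the left coset of its
  inverse. Virtual cyclicity is defined with right cosets, whereas orbits consist of left
  cosets.\<close>

lemma finite_rcosets_iff_lcosets:
  assumes "subgroup C G" "subgroup H G"
  shows "finite ((\<lambda>h. C #> h) ` H) \<longleftrightarrow> finite ((\<lambda>h. h <# C) ` H)"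
proof
  have H: "h \<in> carrier G" "inv h \<in> H" if "h \<in> H" for h
    using that subgroup.mem_carrier[OF assms(2)] subgroup.m_inv_closed[OF assms(2)] by auto
  show "finite ((\<lambda>h. h <# C) ` H)" if "finite ((\<lambda>h. C #> h) ` H)"
  proof (rule finite_subset)
    show "(\<lambda>h. h <# C) ` H \<subseteq> (\<lambda>Y. m_inv G ` Y) ` (\<lambda>h. C #> h) ` H"
    proof (rule image_subsetI)
      fix h assume h: "h \<in> H"
      have "h <# C = m_inv G ` (C #> inv h)" using inv_image_rcoset[OF assms(1), of "inv h"] H[OF h] by simp
      then show "h <# C \<in> (\<lambda>Y. m_inv G ` Y) ` (\<lambda>h. C #> h) ` H" using H(2)[OF h] by blast
    qed
  qed (use that in blast)
  show "finite ((\<lambda>h. C #> h) ` H)" if "finite ((\<lambda>h. h <# C) ` H)"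
  proof (rule finite_subset)
    show "(\<lambda>h. C #> h) ` H \<subseteq> (\<lambda>Y. m_inv G ` Y) ` (\<lambda>h. h <# C) ` H"
    proof (rule image_subsetI)
      fix h assume h: "h \<in> H"
      have "C #> h = m_inv G ` (inv h <# C)" using inv_image_lcoset[OF assms(1)] H[OF h] by simp
      then show "C #> h \<in> (\<lambda>Y. m_inv G ` Y) ` (\<lambda>h. h <# C) ` H" using H(2)[OF h] by blast
    qed
  qed (use that in blast)
qed

lemma cyclic_subgroup_iff:
  assumes "subgroup C G"
  shows "cyclic_group (G\<lparr>carrier := C\<rparr>) \<longleftrightarrow> (\<exists>c\<in>C. C = generate G {c})"
proof -
  have "subgroup_generated (G\<lparr>carrier := C\<rparr>) {c} = G\<lparr>carrier := C\<rparr> \<longleftrightarrow> C = generate G {c}" if "c \<in> C" for c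
  proof -
    have "generate (G\<lparr>carrier := C\<rparr>) {c} = generate G {c}" using generate_consistent[OF _ assms] that by simp
    then have eq: "subgroup_generated (G\<lparr>carrier := C\<rparr>) {c} = G\<lparr>carrier := generate G {c}\<rparr>"
      using that by (simp add: subgroup_generated_def)
    show ?thesis unfolding eq
    proof
      assume "G\<lparr>carrier := generate G {c}\<rparr> = G\<lparr>carrier := C\<rparr>"
      then have "carrier (G\<lparr>carrier := generate G {c}\<rparr>) = carrier (G\<lparr>carrier := C\<rparr>)" by (rule arg_cong)
      then show "C = generate G {c}" by simp
    qed simp
  qed
  then show ?thesis by (auto simp: cyclic_group_def)
qed

text \<open>A form internal to \<open>G\<close>, for use in all later arguments: it speaks only of
  an element and of left cosets in \<open>G\<close>, not of subgroups of a group with restricted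
  carrier.\<close>

lemma virtually_cyclic_subgroup_iff:
  assumes "subgroup H G"
  shows "H \<in> virtually_cyclic_subgroups G \<longleftrightarrow> (\<exists>c\<in>H. finite ((\<lambda>h. h <# generate G {c}) ` H))"
proof -
  have sub: "subgroup C (G\<lparr>carrier := H\<rparr>) \<longleftrightarrow> subgroup C G \<and> C \<subseteq> H" for C
    using incl_subgroup[OF assms] subgroup_incl[OF _ assms] subgroup.subset[of C "G\<lparr>carrier := H\<rparr>"] by auto
  have rc: "rcosets\<^bsub>G\<lparr>carrier := H\<rparr>\<^esub> C = (\<lambda>h. C #> h) ` H" for C
    by (auto simp: RCOSETS_def)
  have "H \<in> virtually_cyclic_subgroups G \<longleftrightarrow>
    (\<exists>C. (subgroup C G \<and> C \<subseteq> H) \<and> cyclic_group (G\<lparr>carrier := C\<rparr>) \<and> finite ((\<lambda>h. C #> h) ` H))"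
    using assms subgroup_imp_group[OF assms]
    by (simp add: virtually_cyclic_subgroups_def virtually_cyclic_group_def sub rc)
  also have "\<dots> \<longleftrightarrow>
    (\<exists>C. subgroup C G \<and> C \<subseteq> H \<and> (\<exists>c\<in>C. C = generate G {c}) \<and> finite ((\<lambda>h. C #> h) ` H))"
    using cyclic_subgroup_iff by blast
  also have "\<dots> \<longleftrightarrow> (\<exists>c\<in>H. finite ((\<lambda>h. h <# generate G {c}) ` H))"
  proof
    assume "\<exists>C. subgroup C G \<and> C \<subseteq> H \<and> (\<exists>c\<in>C. C = generate G {c}) \<and> finite ((\<lambda>h. C #> h) ` H)"
    then show "\<exists>c\<in>H. finite ((\<lambda>h. h <# generate G {c}) ` H)"
      using finite_rcosets_iff_lcosets[OF _ assms] by (metis subsetD)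
  next
    assume "\<exists>c\<in>H. finite ((\<lambda>h. h <# generate G {c}) ` H)"
    then obtain c where c: "c \<in> H" "finite ((\<lambda>h. h <# generate G {c}) ` H)" by blast
    then have "c \<in> carrier G" using subgroup.mem_carrier[OF assms] by blast
    then have s: "subgroup (generate G {c}) G" by (rule generate_singleton_subgroup)
    have "generate G {c} \<subseteq> H" using generate_subgroup_incl[OF _ assms] c by simp
    moreover have "c \<in> generate G {c}" by (simp add: generate.incl)
    ultimately show "\<exists>C. subgroup C G \<and> C \<subseteq> H \<and> (\<exists>c\<in>C. C = generate G {c}) \<and> finite ((\<lambda>h. C #> h) ` H)"
      using s c finite_rcosets_iff_lcosets[OF s assms] by blast
  qed
  finally show ?thesis .
qed

lemma trivial_virtually_cyclic: "{\<one>} \<in> virtually_cyclic_subgroups G"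
  using virtually_cyclic_subgroup_iff[OF triv_subgroup] by simp

text \<open>A generator of the cyclic subgroup and a finite set \<open>R\<close> meeting each of its
  left cosets suffice: if h and r lie in the same left coset, then r\<inverse>h is in the cyclic
  subgroup and h = r(r\<inverse>h).\<close>

lemma virtually_cyclic_finitely_generated:
  assumes "H \<in> virtually_cyclic_subgroups G"
  shows "\<exists>S. finite S \<and> S \<subseteq> H \<and> H = generate G S"
proof -
  have H: "subgroup H G" using assms by (simp add: virtually_cyclic_subgroups_def)
  obtain c where c: "c \<in> H" "finite ((\<lambda>h. h <# generate G {c}) ` H)"
    using assms virtually_cyclic_subgroup_iff[OF H] by blast
  have cs: "subgroup (generate G {c}) G"
    using generate_singleton_subgroup subgroup.mem_carrier[OF H] c by blast
  obtain R where R: "R \<subseteq> H" "finite R" "(\<lambda>h. h <# generate G {c}) ` H = (\<lambda>h. h <# generate G {c}) ` R"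
    using finite_subset_image[OF c(2) subset_refl] by blast
  have RH: "insert c R \<subseteq> H" using c R by blast
  have RG: "subgroup (generate G (insert c R)) G"
    using generate_is_subgroup RH subgroup.subset[OF H] by blast
  have "h \<in> generate G (insert c R)" if h: "h \<in> H" for h
  proof -
    have "h <# generate G {c} \<in> (\<lambda>h. h <# generate G {c}) ` R" using h unfolding R(3)[symmetric] by (rule imageI)
    then obtain r where r: "r \<in> R" "r <# generate G {c} = h <# generate G {c}" by force
    have hr: "h \<in> carrier G" "r \<in> carrier G" using h r R subgroup.subset[OF H] by auto
    then have "inv r \<otimes> h \<in> generate G {c}" using lcoset_eq_iff[OF cs] r by blast
    then have "inv r \<otimes> h \<in> generate G (insert c R)" using mono_generate[of "{c}" "insert c R"] by blast
    moreover have "r \<in> generate G (insert c R)" using r by (simp add: generate.incl)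
    ultimately have "r \<otimes> (inv r \<otimes> h) \<in> generate G (insert c R)" using subgroup.m_closed[OF RG] by blast
    then show ?thesis using hr by (simp flip: m_assoc)
  qed
  moreover have "generate G (insert c R) \<subseteq> H" by (rule generate_subgroup_incl[OF RH H])
  ultimately have "H = generate G (insert c R)" by blast
  then show ?thesis using RH R(2) by blast
qed

text \<open>If \<open>n\<close> is the least positive exponent with d^n in \<open>E\<close>, the
  remainder modulo \<open>n\<close> of any exponent occurring in \<open>E\<close> occurs too and
  must be 0. If no positive exponent occurs, neither does a negative one, as \<open>E\<close> is
  closed under inverses, and \<open>E\<close> is trivial.\<close>

lemma subgroup_of_cyclic:
  assumes d: "d \<in> carrier G" and E: "subgroup E G" "E \<subseteq> generate G {d}"
  shows "\<exists>e\<in>E. E = generate G {e}"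
proof (cases "\<exists>n::nat. 0 < n \<and> d [^] n \<in> E")
  case False
  have "x = \<one>" if x: "x \<in> E" for x
  proof -
    obtain k :: int where k: "x = d [^] k" using x E generate_pow[OF d] by auto
    have "inv x \<in> E" using subgroup.m_inv_closed[OF E(1) x] .
    have "d [^] nat \<bar>k\<bar> \<in> E"
    proof (cases "k < 0")
      case True
      then have "inv x = d [^] nat \<bar>k\<bar>" unfolding k int_pow_def2 using d by (simp only: if_True) simp
      then show ?thesis using \<open>inv x \<in> E\<close> by simp
    next
      case False
      then have "x = d [^] nat \<bar>k\<bar>" unfolding k int_pow_def2 by simp
      then show ?thesis using x by simp
    qed
    with False have "\<not> 0 < nat \<bar>k\<bar>" by (intro notI) (erule notE, intro exI conjI)
    then have "k = 0" by simp
    then show ?thesis using k by simp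
  qed
  then have "E = {\<one>}" using subgroup.one_closed[OF E(1)] by blast
  moreover have "generate G {\<one>} = {\<one>}" using generate_one by simp
  ultimately show ?thesis by simp
next
  case True
  define n where "n = (LEAST n::nat. 0 < n \<and> d [^] n \<in> E)"
  have n: "0 < n" "d [^] n \<in> E" using LeastI_ex[OF True] by (auto simp: n_def)
  have min: "\<not> (0 < m \<and> d [^] m \<in> E)" if "m < n" for m :: nat
    using not_less_Least that unfolding n_def by blast
  have nG: "d [^] n \<in> carrier G" using d by simp
  have gE: "generate G {d [^] n} \<subseteq> E" using generate_subgroup_incl[OF _ E(1)] n by simp
  have "x \<in> generate G {d [^] n}" if x: "x \<in> E" for x
  proof -
    obtain k :: int where k: "x = d [^] k" using x E generate_pow[OF d] by auto
    define r where "r = nat (k mod int n)"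
    have r: "int r = k mod int n" "r < n" using n(1) by (auto simp: r_def nat_less_iff)
    have q: "(d [^] n) [^] (k div int n) \<in> generate G {d [^] n}" using generate_pow[OF nG] by blast
    have "k = int n * (k div int n) + int r" using r(1) by simp
    then have "x = d [^] (int n * (k div int n)) \<otimes> d [^] int r" using k int_pow_mult[OF d] by metis
    then have x_eq: "x = (d [^] n) [^] (k div int n) \<otimes> d [^] r"
      using d by (simp add: int_pow_int flip: int_pow_pow)
    have "inv ((d [^] n) [^] (k div int n)) \<otimes> x \<in> E"
      using q gE x subgroup.m_closed[OF E(1)] subgroup.m_inv_closed[OF E(1)] by blast
    then have "d [^] r \<in> E" using x_eq d by (simp flip: m_assoc)
    then have "r = 0" using min[OF r(2)] by simp
    then show ?thesis using x_eq q d by simp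
  qed
  then have "E = generate G {d [^] n}" using gE by blast
  then show ?thesis using n by blast
qed

text \<open>The stabilizer in \<open>T\<close> of a coset \<open>gC\<close> of a cyclic finite index subgroup \<open>C\<close> of \<open>K\<close> is a
  subgroup of the cyclic group \<open>gCg\<inverse>\<close>, and has finite index as the orbit of \<open>gC\<close> lies over \<open>Z\<close>.\<close>

lemma virtually_cyclic_if_finite_invariant:
  assumes K: "K \<in> virtually_cyclic_subgroups G" and T: "subgroup T G"
    and Z: "finite Z" "Z \<noteq> {}" "Z \<subseteq> lcosets K"
    and inv: "\<And>t A. \<lbrakk>t \<in> T; A \<in> Z\<rbrakk> \<Longrightarrow> t <# A \<in> Z"
  shows "T \<in> virtually_cyclic_subgroups G"
proof -
  have K': "subgroup K G" using K by (simp add: virtually_cyclic_subgroups_def)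
  obtain c where c: "c \<in> K" "finite ((\<lambda>k. k <# generate G {c}) ` K)"
    using K virtually_cyclic_subgroup_iff[OF K'] by blast
  define C where "C = generate G {c}"
  have cG: "c \<in> carrier G" using c subgroup.mem_carrier[OF K'] by blast
  have C: "subgroup C G" unfolding C_def by (rule generate_singleton_subgroup[OF cG])
  have CG: "C \<subseteq> carrier G" by (rule subgroup.subset[OF C])
  obtain g where g: "g \<in> carrier G" "g <# K \<in> Z" using Z by (auto simp: LCOSETS_def)
  have TG: "t \<in> carrier G" if "t \<in> T" for t using subgroup.mem_carrier[OF T that] .
  \<comment> \<open>The condition \<open>inv g \<otimes> t \<otimes> g \<in> C\<close> says that
    \<open>t\<close> fixes the coset gC. The element \<open>d\<close> introduced next generates
    gCg\<inverse>.\<close>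
  define E where "E = {t \<in> T. inv g \<otimes> t \<otimes> g \<in> C}"
  define d where "d = g \<otimes> c \<otimes> inv g"
  have d: "d \<in> carrier G" using g cG by (simp add: d_def)
  have E: "subgroup E G"
  proof
    show "E \<subseteq> carrier G" using TG by (auto simp: E_def)
    show "\<one> \<in> E" using subgroup.one_closed[OF T] subgroup.one_closed[OF C] g by (simp add: E_def)
    fix x assume x: "x \<in> E"
    have "inv (inv g \<otimes> x \<otimes> g) \<in> C" using x subgroup.m_inv_closed[OF C] by (simp add: E_def)
    moreover have "inv (inv g \<otimes> x \<otimes> g) = inv g \<otimes> inv x \<otimes> g"
      using x TG g by (simp add: E_def inv_mult_group m_assoc)
    ultimately show "inv x \<in> E" using x subgroup.m_inv_closed[OF T] by (simp add: E_def)
    fix y assume y: "y \<in> E"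
    have "(inv g \<otimes> x \<otimes> g) \<otimes> (inv g \<otimes> y \<otimes> g) \<in> C" using x y subgroup.m_closed[OF C] by (simp add: E_def)
    moreover have "(inv g \<otimes> x \<otimes> g) \<otimes> (inv g \<otimes> y \<otimes> g) = inv g \<otimes> (x \<otimes> y) \<otimes> g"
    proof -
      have "x \<in> carrier G" "y \<in> carrier G" using x y TG by (auto simp: E_def)
      have "(inv g \<otimes> x \<otimes> g) \<otimes> (inv g \<otimes> y \<otimes> g) = inv g \<otimes> x \<otimes> (g \<otimes> inv g) \<otimes> y \<otimes> g"
        using g(1) \<open>x \<in> carrier G\<close> \<open>y \<in> carrier G\<close> by (simp only: m_assoc m_closed inv_closed)
      also have "\<dots> = inv g \<otimes> (x \<otimes> y) \<otimes> g"
        unfolding r_inv[OF g(1)] using g(1) \<open>x \<in> carrier G\<close> \<open>y \<in> carrier G\<close> by (simp add: m_assoc)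
      finally show ?thesis .
    qed
    ultimately show "x \<otimes> y \<in> E" using x y subgroup.m_closed[OF T] by (simp add: E_def)
  qed
  have conj_pow: "g \<otimes> c [^] k \<otimes> inv g \<in> generate G {d}" for k :: int
  proof -
    have "(\<lambda>x. g \<otimes> x \<otimes> inv g) \<in> hom G G"
    proof (rule homI)
      fix x y assume xy: "x \<in> carrier G" "y \<in> carrier G"
      have "(g \<otimes> x \<otimes> inv g) \<otimes> (g \<otimes> y \<otimes> inv g) = g \<otimes> x \<otimes> (inv g \<otimes> g) \<otimes> y \<otimes> inv g"
        using g(1) xy by (simp only: m_assoc m_closed inv_closed)
      also have "\<dots> = g \<otimes> (x \<otimes> y) \<otimes> inv g"
        unfolding l_inv[OF g(1)] using g(1) xy by (simp add: m_assoc)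
      finally show "g \<otimes> (x \<otimes> y) \<otimes> inv g = (g \<otimes> x \<otimes> inv g) \<otimes> (g \<otimes> y \<otimes> inv g)" ..
    qed (use g in simp)
    then interpret group_hom G G "\<lambda>x. g \<otimes> x \<otimes> inv g"
      by (simp add: group_hom_def group_hom_axioms_def is_group)
    have "g \<otimes> c [^] k \<otimes> inv g = d [^] k" using hom_int_pow[OF cG, of k] by (simp add: d_def)
    then show ?thesis using generate_pow[OF d] by blast
  qed
  have "E \<subseteq> generate G {d}"
  proof
    fix t assume t: "t \<in> E"
    then obtain k :: int where k: "inv g \<otimes> t \<otimes> g = c [^] k"
      using generate_pow[OF cG] by (auto simp: E_def C_def)
    have tG: "t \<in> carrier G" using t TG by (simp add: E_def)
    have "t = (g \<otimes> inv g) \<otimes> t \<otimes> (g \<otimes> inv g)" using g(1) tG by simp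
    also have "\<dots> = g \<otimes> (inv g \<otimes> t \<otimes> g) \<otimes> inv g" using g(1) tG by (simp only: m_assoc m_closed inv_closed)
    finally show "t \<in> generate G {d}" using conj_pow[of k] k by simp
  qed
  then obtain e where e: "e \<in> E" "E = generate G {e}" using subgroup_of_cyclic[OF d E] by blast
  \<comment> \<open>The coset aK is a translate of K, so it too consists of finitely many left
    cosets of \<open>C\<close>.\<close>
  have "finite ((\<lambda>x. x <# C) ` A)" if A: "A \<in> lcosets K" for A
  proof -
    obtain a where a: "a \<in> carrier G" "A = a <# K" using A by (rule lcosetsE)
    have "(\<lambda>x. x <# C) ` A = (\<lambda>Y. a <# Y) ` (\<lambda>k. k <# C) ` K"
    proof -
      have "(a \<otimes> k) <# C = a <# (k <# C)" if "k \<in> K" for k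
        using a CG subgroup.mem_carrier[OF K' that] by (simp add: lcos_m_assoc)
      moreover have "A = (\<lambda>k. a \<otimes> k) ` K" using a by (auto simp: l_coset_def)
      ultimately show ?thesis by (simp add: image_image)
    qed
    then show ?thesis using c(2) by (simp add: C_def)
  qed
  then have "finite (\<Union>A\<in>Z. (\<lambda>x. x <# C) ` A)" using Z by blast
  moreover have "(\<lambda>t. (t \<otimes> g) <# C) ` T \<subseteq> (\<Union>A\<in>Z. (\<lambda>x. x <# C) ` A)"
  proof (rule image_subsetI)
    fix t assume t: "t \<in> T"
    have "t <# (g <# K) \<in> Z" using inv t g by blast
    then have "(t \<otimes> g) <# K \<in> Z" using t TG g subgroup.subset[OF K'] by (simp add: lcos_m_assoc)
    moreover have "t \<otimes> g \<in> (t \<otimes> g) <# K" using lcos_self[OF _ K'] t TG g by blast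
    ultimately show "(t \<otimes> g) <# C \<in> (\<Union>A\<in>Z. (\<lambda>x. x <# C) ` A)" by blast
  qed
  ultimately have "finite ((\<lambda>t. (t \<otimes> g) <# C) ` T)" by (rule rev_finite_subset)
  \<comment> \<open>If sgC = tgC, then s\<inverse>t fixes gC and lies in \<open>E\<close>; so the
    left cosets of \<open>E\<close> in \<open>T\<close> are no more numerous than the cosets
    tgC.\<close>
  then have "finite ((\<lambda>t. t <# E) ` T)"
  proof (rule finite_image_factor)
    fix s t assume st: "s \<in> T" "t \<in> T" "(s \<otimes> g) <# C = (t \<otimes> g) <# C"
    have G: "s \<in> carrier G" "t \<in> carrier G" using st TG by auto
    have "inv (s \<otimes> g) \<otimes> (t \<otimes> g) \<in> C" using st(3) lcoset_eq_iff[OF C] G g by simp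
    then have "inv g \<otimes> (inv s \<otimes> t) \<otimes> g \<in> C" using G g(1) by (simp add: inv_mult_group m_assoc)
    then have "inv s \<otimes> t \<in> E"
      using st subgroup.m_closed[OF T] subgroup.m_inv_closed[OF T] by (simp add: E_def)
    then show "s <# E = t <# E" using lcoset_eq_iff[OF E] G by blast
  qed
  moreover have "e \<in> T" using e by (simp add: E_def)
  ultimately show ?thesis using virtually_cyclic_subgroup_iff[OF T] e(2) by metis
qed

text \<open>Translation by an element of \<open>S\<close> is injective, hence a bijection of the
  finite set \<open>Z\<close>, so its inverse preserves \<open>Z\<close> too. Closure under
  \<open>S\<close> thereby becomes invariance under the generated group.\<close>

lemma virtually_cyclic_if_finite_closed:
  assumes K: "K \<in> virtually_cyclic_subgroups G" and S: "S \<subseteq> carrier G"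
    and Z: "finite Z" "Z \<noteq> {}" "Z \<subseteq> lcosets K"
    and closed: "\<And>s A. \<lbrakk>s \<in> S; A \<in> Z\<rbrakk> \<Longrightarrow> s <# A \<in> Z"
  shows "generate G S \<in> virtually_cyclic_subgroups G"
proof (rule virtually_cyclic_if_finite_invariant[OF K generate_is_subgroup[OF S] Z])
  have "subgroup K G" using K by (simp add: virtually_cyclic_subgroups_def)
  then have sub: "A \<subseteq> carrier G" if "A \<in> Z" for A
    using that Z subgroup.lcosets_carrier[OF _ is_group] by blast
  have one_img: "(\<lambda>A. \<one> <# A) ` Z = Z" using lcos_mult_one[OF sub] by simp
  have cancel: "a <# (inv a <# A) = A" "inv a <# (a <# A) = A" if "A \<in> Z" "a \<in> carrier G" for a A
    using that sub[OF that(1)] by (simp_all add: lcos_m_assoc lcos_mult_one)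
  have gen_img: "(\<lambda>A. s <# A) ` Z = Z" if s: "s \<in> S" for s
  proof (rule endo_inj_surj[OF Z(1)])
    have sG: "s \<in> carrier G" using s S by blast
    show "(\<lambda>A. s <# A) ` Z \<subseteq> Z" using closed[OF s] by (rule image_subsetI)
    show "inj_on (\<lambda>A. s <# A) Z" by (rule inj_on_inverseI[where g = "\<lambda>A. inv s <# A"]) (rule cancel(2)[OF _ sG])
  qed
  have img: "(\<lambda>A. t <# A) ` Z = Z" if "t \<in> generate G S" for t
    using that
  proof (induction rule: generate.induct)
    case one show ?case by (rule one_img)
  next
    case (incl s)
    then show ?case by (rule gen_img)
  next
    case (inv s)
    then have sG: "s \<in> carrier G" using S by blast
    have "(\<lambda>A. inv s <# A) ` Z = (\<lambda>A. inv s <# A) ` (\<lambda>A. s <# A) ` Z" using gen_img[OF inv] by simp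
    also have "\<dots> = (\<lambda>A. inv s <# (s <# A)) ` Z" by (rule image_image)
    also have "\<dots> = (\<lambda>A. A) ` Z" by (rule image_cong[OF refl cancel(2)[OF _ sG]])
    finally show ?case by simp
  next
    case (eng s t)
    have "s \<in> carrier G" "t \<in> carrier G" using eng generate_in_carrier[OF S] by auto
    then have "(\<lambda>A. (s \<otimes> t) <# A) ` Z = (\<lambda>A. s <# A) ` (\<lambda>A. t <# A) ` Z"
      using sub by (simp add: image_image lcos_m_assoc)
    then show ?case using eng by simp
  qed
  show "t <# A \<in> Z" if "t \<in> generate G S" "A \<in> Z" for t A using img[OF that(1)] that(2) by blast
qed

section \<open>Local virtual cyclicity as directedness of the family\<close>

lemma subgroup_generated_virtually_cyclic_iff:
  assumes "S \<subseteq> carrier G"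
  shows "virtually_cyclic_group (subgroup_generated G S) \<longleftrightarrow> generate G S \<in> virtually_cyclic_subgroups G"
  using assms generate_is_subgroup[OF assms]
  by (simp add: subgroup_generated_def virtually_cyclic_subgroups_def Int_absorb1)

lemma locally_virtually_cyclic_directed:
  assumes "locally_virtually_cyclic G"
  shows "directed_family G (virtually_cyclic_subgroups G)"
proof (intro directed_family.intro subgroup_family.intro subgroup_family_axioms.intro directed_family_axioms.intro is_group)
  show "virtually_cyclic_subgroups G \<noteq> {}" using trivial_virtually_cyclic by blast
  have sub: "subgroup H G" if "H \<in> virtually_cyclic_subgroups G" for H
    using that by (simp add: virtually_cyclic_subgroups_def)
  show "subgroup H G" if "H \<in> virtually_cyclic_subgroups G" for H using sub[OF that] .
  fix H K a
  assume H: "H \<in> virtually_cyclic_subgroups G" and K: "K \<in> virtually_cyclic_subgroups G" and a: "a \<in> carrier G"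
  obtain S where S: "finite S" "S \<subseteq> H" "H = generate G S" using virtually_cyclic_finitely_generated[OF H] by blast
  obtain R where R: "finite R" "R \<subseteq> K" "K = generate G R" using virtually_cyclic_finitely_generated[OF K] by blast
  let ?X = "insert a (S \<union> R)"
  have X: "finite ?X" "?X \<subseteq> carrier G"
    using S R a subgroup.subset[OF sub[OF H]] subgroup.subset[OF sub[OF K]] by auto
  then have "generate G ?X \<in> virtually_cyclic_subgroups G"
    using assms subgroup_generated_virtually_cyclic_iff by (simp add: locally_virtually_cyclic_def)
  moreover have "H \<subseteq> generate G ?X" "K \<subseteq> generate G ?X"
    using mono_generate[of S ?X] mono_generate[of R ?X] S R by blast+
  moreover have "a \<in> generate G ?X" by (simp add: generate.incl)
  ultimately show "\<exists>L\<in>virtually_cyclic_subgroups G. H \<subseteq> L \<and> K \<subseteq> L \<and> a \<in> L" by blast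
qed

end

section \<open>Modules with values in a prescribed infinite type\<close>

text \<open>The map \<open>f\<close> read through the encodings \<open>e\<close> and
  \<open>e'\<close>. The preimage is chosen arbitrarily; the choice is immaterial once
  \<open>f\<close> maps the kernel of \<open>e\<close> into that of \<open>e'\<close>.\<close>

definition induced_map :: "('x \<Rightarrow> 'y) \<Rightarrow> ('z \<Rightarrow> 'w) \<Rightarrow> 'x set \<Rightarrow> ('x \<Rightarrow> 'z) \<Rightarrow> 'y \<Rightarrow> 'w" where
  "induced_map e e' A f = (\<lambda>y. e' (f (inv_into A e y)))"

text \<open>The encoding \<open>e U\<close> is allowed to have a kernel, so the same construction
  yields an isomorphic copy of a module as well as a copy of a quotient module.\<close>

definition image_module ::
  "('a set set \<Rightarrow> 'x \<Rightarrow> 'y) \<Rightarrow> ('a, 'x) orbit_module \<Rightarrow> ('a, 'y) orbit_module" where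
  "image_module e N =
    \<lparr>mval = (\<lambda>U. image_group (e U) (mval N U)),
     mact = (\<lambda>U V \<phi>. induced_map (e U) (e V) (carrier (mval N U)) (mact N U V \<phi>))\<rparr>"

lemma image_group_hom:
  assumes "Group.group A" "weak_group_morphism e K A"
  shows "Group.group (image_group e A)" "e \<in> hom A (image_group e A)"
  using group.image_group_is_group[OF assms] group.weak_group_morphism_is_hom[OF assms] .

lemma weak_group_morphism_eq_one_iff:
  assumes "Group.group A" "weak_group_morphism e K A" "x \<in> carrier A"
  shows "e x = \<one>\<^bsub>image_group e A\<^esub> \<longleftrightarrow> x \<in> K"
proof -
  interpret A: group A by fact
  have "x \<otimes>\<^bsub>A\<^esub> inv\<^bsub>A\<^esub> \<one>\<^bsub>A\<^esub> = x" using assms(3) by simp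
  then show ?thesis
    using weak_group_morphism.inj_mod_subgroup[OF assms(2,3) A.one_closed] by (simp add: image_group_one)
qed

text \<open>The chosen preimage and \<open>x\<close> differ by an element of \<open>K\<close>, which
  \<open>f\<close> sends into \<open>K'\<close>, and \<open>e'\<close> does not distinguish elements
  differing by \<open>K'\<close>.\<close>

lemma induced_map_eq:
  assumes "Group.group A" "weak_group_morphism e K A" "Group.group A'" "weak_group_morphism e' K' A'"
    and f: "f \<in> hom A A'" "f ` K \<subseteq> K'" and x: "x \<in> carrier A"
  shows "induced_map e e' (carrier A) f (e x) = e' (f x)"
proof -
  interpret group_hom A A' f using assms by (simp add: group_hom_def group_hom_axioms_def)
  let ?z = "inv_into (carrier A) e (e x)"
  have z: "?z \<in> carrier A" "e ?z = e x" using x by (auto simp: inv_into_into f_inv_into_f)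
  have "?z \<otimes>\<^bsub>A\<^esub> inv\<^bsub>A\<^esub> x \<in> K" using weak_group_morphism.inj_mod_subgroup[OF assms(2) z(1) x] z(2) by simp
  then have "f (?z \<otimes>\<^bsub>A\<^esub> inv\<^bsub>A\<^esub> x) \<in> K'" using f by blast
  then have "f ?z \<otimes>\<^bsub>A'\<^esub> inv\<^bsub>A'\<^esub> f x \<in> K'" using z x by simp
  then show ?thesis
    unfolding induced_map_def using weak_group_morphism.inj_mod_subgroup[OF assms(4)] z x by simp
qed

lemma induced_map_hom:
  assumes "Group.group A" "weak_group_morphism e K A" "Group.group A'" "weak_group_morphism e' K' A'"
    and f: "f \<in> hom A A'" "f ` K \<subseteq> K'"
  shows "induced_map e e' (carrier A) f \<in> hom (image_group e A) (image_group e' A')"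
proof -
  interpret A: group A by fact
  interpret f: group_hom A A' f using assms by (simp add: group_hom_def group_hom_axioms_def)
  note eq = induced_map_eq[OF assms]
  note e = image_group_hom(2)[OF assms(1,2)] and e' = image_group_hom(2)[OF assms(3,4)]
  show ?thesis
  proof (rule homI)
    fix y assume "y \<in> carrier (image_group e A)"
    then obtain x where x: "x \<in> carrier A" "y = e x" by (auto simp: image_group_carrier)
    then show "induced_map e e' (carrier A) f y \<in> carrier (image_group e' A')"
      using eq[OF x(1)] hom_in_carrier[OF e'] by simp
    fix y' assume "y' \<in> carrier (image_group e A)"
    then obtain x' where x': "x' \<in> carrier A" "y' = e x'" by (auto simp: image_group_carrier)
    have "y \<otimes>\<^bsub>image_group e A\<^esub> y' = e (x \<otimes>\<^bsub>A\<^esub> x')" using hom_mult[OF e] x x' by simp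
    then show "induced_map e e' (carrier A) f (y \<otimes>\<^bsub>image_group e A\<^esub> y') =
      induced_map e e' (carrier A) f y \<otimes>\<^bsub>image_group e' A'\<^esub> induced_map e e' (carrier A) f y'"
      using x x' eq[OF x(1)] eq[OF x'(1)] eq[of "x \<otimes>\<^bsub>A\<^esub> x'"] hom_mult[OF e'] by simp
  qed
qed

text \<open>The cosets of \<open>K\<close> are countable in number, so they can be numbered, and the
  natural numbers embed into an infinite type. An element is encoded by the code of its
  coset.\<close>

lemma exists_encoding:
  fixes A :: "('x, 'c) monoid_scheme"
  assumes "Group.group A" "K \<lhd> A" "countable (carrier A)" "infinite (UNIV :: 'u set)"
  shows "\<exists>e :: 'x \<Rightarrow> 'u. weak_group_morphism e K A"
proof -
  interpret A: group A by fact
  interpret K: normal K A by fact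
  obtain i :: "nat \<Rightarrow> 'u" where i: "inj i" using infinite_countable_subset[OF assms(4)] by blast
  let ?R = "(\<lambda>x. K #>\<^bsub>A\<^esub> x) ` carrier A"
  have R: "countable ?R" using assms(3) by blast
  let ?e = "\<lambda>x. i (to_nat_on ?R (K #>\<^bsub>A\<^esub> x))"
  have "?e a = ?e b \<longleftrightarrow> a \<otimes>\<^bsub>A\<^esub> inv\<^bsub>A\<^esub> b \<in> K" if ab: "a \<in> carrier A" "b \<in> carrier A" for a b
  proof -
    have "?e a = ?e b \<longleftrightarrow> K #>\<^bsub>A\<^esub> a = K #>\<^bsub>A\<^esub> b"
      using i R ab by (simp add: inj_eq)
    also have "\<dots> \<longleftrightarrow> a \<in> K #>\<^bsub>A\<^esub> b"
      using A.repr_independence[OF _ ab(2) K.subgroup_axioms] A.rcos_self[OF ab(1) K.subgroup_axioms] by auto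
    also have "\<dots> \<longleftrightarrow> a \<otimes>\<^bsub>A\<^esub> inv\<^bsub>A\<^esub> b \<in> K" by (rule K.rcos_module[OF assms(1) ab(2,1)])
    finally show ?thesis .
  qed
  then have "weak_group_morphism ?e K A" by (intro weak_group_morphismsI assms(2))
  then show ?thesis by (rule exI[of _ ?e])
qed

text \<open>By \<open>act_kernel\<close> the subgroups \<open>K U\<close> form a submodule, so
  \<open>image_module e N\<close> is the quotient of \<open>N\<close> by \<open>K\<close> with
  values coded in another type.\<close>

locale module_encoding = subgroup_family G F for G :: "('a, 'b) monoid_scheme" (structure) and F +
  fixes N :: "('a, 'x) orbit_module" and K :: "'a set set \<Rightarrow> 'x set" and e :: "'a set set \<Rightarrow> 'x \<Rightarrow> 'y"
  assumes left: "left_module G F N"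
    and weak: "U \<in> orbit_objects G F \<Longrightarrow> weak_group_morphism (e U) (K U) (mval N U)"
    and act_kernel: "\<lbrakk>U \<in> orbit_objects G F; V \<in> orbit_objects G F; \<phi> \<in> orbit_hom G U V\<rbrakk>
      \<Longrightarrow> mact N U V \<phi> ` K U \<subseteq> K V"
begin

lemma comm_group_at: "U \<in> orbit_objects G F \<Longrightarrow> comm_group (mval N U)"
  using left by (simp add: left_module_def)

lemma group_at: "U \<in> orbit_objects G F \<Longrightarrow> Group.group (mval N U)"
  by (simp add: comm_group_at comm_group.axioms(2))

lemma act_hom:
  "\<lbrakk>U \<in> orbit_objects G F; V \<in> orbit_objects G F; \<phi> \<in> orbit_hom G U V\<rbrakk>
    \<Longrightarrow> mact N U V \<phi> \<in> hom (mval N U) (mval N V)"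
  using left by (simp add: left_module_def)

lemma mval_image [simp]: "mval (image_module e N) U = image_group (e U) (mval N U)"
  by (simp add: image_module_def)

lemma image_elementE:
  assumes "y \<in> carrier (image_group (e U) (mval N U))"
  obtains x where "x \<in> carrier (mval N U)" "y = e U x"
  using assms by (auto simp: image_group_carrier)

lemma e_hom: "U \<in> orbit_objects G F \<Longrightarrow> e U \<in> hom (mval N U) (image_group (e U) (mval N U))"
  using image_group_hom(2)[OF group_at weak] .

lemma mact_image:
  assumes "U \<in> orbit_objects G F" "V \<in> orbit_objects G F" "\<phi> \<in> orbit_hom G U V" "x \<in> carrier (mval N U)"
  shows "mact (image_module e N) U V \<phi> (e U x) = e V (mact N U V \<phi> x)"
  unfolding image_module_def
  using induced_map_eq[OF group_at weak group_at weak act_hom act_kernel] assms by simp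

lemma comm_group_image:
  assumes U: "U \<in> orbit_objects G F"
  shows "comm_group (image_group (e U) (mval N U))"
proof (rule group.group_comm_groupI)
  interpret A: comm_group "mval N U" by (rule comm_group_at[OF U])
  show "Group.group (image_group (e U) (mval N U))" using image_group_hom(1)[OF group_at weak] U by blast
  fix y z assume "y \<in> carrier (image_group (e U) (mval N U))" "z \<in> carrier (image_group (e U) (mval N U))"
  then obtain a b where ab: "a \<in> carrier (mval N U)" "y = e U a" "b \<in> carrier (mval N U)" "z = e U b"
    by (auto simp: image_group_carrier)
  have "e U a \<otimes>\<^bsub>image_group (e U) (mval N U)\<^esub> e U b = e U b \<otimes>\<^bsub>image_group (e U) (mval N U)\<^esub> e U a"
    using hom_mult[OF e_hom[OF U] ab(1,3)] hom_mult[OF e_hom[OF U] ab(3,1)] A.m_comm[OF ab(1,3)] by simp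
  then show "y \<otimes>\<^bsub>image_group (e U) (mval N U)\<^esub> z = z \<otimes>\<^bsub>image_group (e U) (mval N U)\<^esub> y"
    using ab by simp
qed

lemma left_module_image: "left_module G F (image_module e N)"
  unfolding left_module_def mval_image
proof (intro conjI ballI)
  show "comm_group (image_group (e U) (mval N U))" if "U \<in> orbit_objects G F" for U
    by (rule comm_group_image[OF that])
next
  fix U V \<phi> assume a: "U \<in> orbit_objects G F" "V \<in> orbit_objects G F" "\<phi> \<in> orbit_hom G U V"
  show "mact (image_module e N) U V \<phi> \<in> hom (image_group (e U) (mval N U)) (image_group (e V) (mval N V))"
    unfolding image_module_def using induced_map_hom[OF group_at weak group_at weak act_hom act_kernel] a by simp
next
  fix U n assume U: "U \<in> orbit_objects G F" and n: "n \<in> carrier (image_group (e U) (mval N U))"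
  obtain x where x: "x \<in> carrier (mval N U)" "n = e U x" using n by (rule image_elementE)
  show "mact (image_module e N) U U (\<lambda>A\<in>U. A) n = n"
    unfolding x(2) mact_image[OF U U orbit_id_hom[OF U] x(1)] using left U x by (simp add: left_module_def)
next
  fix U V W \<phi> \<psi> n
  assume a: "U \<in> orbit_objects G F" "V \<in> orbit_objects G F" "W \<in> orbit_objects G F"
    "\<phi> \<in> orbit_hom G U V" "\<psi> \<in> orbit_hom G V W" "n \<in> carrier (image_group (e U) (mval N U))"
  obtain x where x: "x \<in> carrier (mval N U)" "n = e U x" using a(6) by (rule image_elementE)
  have c: "mact N U V \<phi> x \<in> carrier (mval N V)" using hom_in_carrier[OF act_hom] a x by blast
  have "compose U \<psi> \<phi> \<in> orbit_hom G U W" using orbit_hom_compose[OF a(1) a(4,5)] .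
  then show "mact (image_module e N) U W (compose U \<psi> \<phi>) n =
      mact (image_module e N) V W \<psi> (mact (image_module e N) U V \<phi> n)"
    unfolding x(2) using a x c left by (simp add: mact_image) (simp add: left_module_def)
qed

end

section \<open>The free module on the points of the orbits\<close>

definition points_module :: "('a, 'a set \<Rightarrow>\<^sub>0 int) orbit_module" where
  "points_module = \<lparr>mval = free_Abelian_group, mact = (\<lambda>U V \<phi>. frag_extend (frag_of \<circ> \<phi>))\<rparr>"

lemma mval_points [simp]: "mval points_module U = free_Abelian_group U"
  and mact_points [simp]: "mact points_module U V \<phi> = frag_extend (frag_of \<circ> \<phi>)"
  by (simp_all add: points_module_def)

lemma frag_extend_frag_extend: "frag_extend f (frag_extend g c) = frag_extend (frag_extend f \<circ> g) c"
  using subset_UNIV by (induction c rule: frag_induction) (auto simp: frag_extend_diff)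

lemma frag_extend_frag_of_hom:
  fixes \<phi> :: "'x \<Rightarrow> 'y"
  assumes "\<phi> ` U \<subseteq> V"
  shows "frag_extend (frag_of \<circ> \<phi>) \<in> hom (free_Abelian_group U) (free_Abelian_group V)"
proof (rule homI)
  fix c :: "'x \<Rightarrow>\<^sub>0 int" assume "c \<in> carrier (free_Abelian_group U)"
  then have "(\<Union>x\<in>Poly_Mapping.keys c. Poly_Mapping.keys ((frag_of \<circ> \<phi>) x)) \<subseteq> V" using assms by auto
  then show "frag_extend (frag_of \<circ> \<phi>) c \<in> carrier (free_Abelian_group V)"
    using keys_frag_extend[of "frag_of \<circ> \<phi>" c] by (simp add: subset_trans)
qed (simp add: frag_extend_add)

text \<open>A finitely supported function is determined by its graph over the support, a finite
  subset of a countable set.\<close>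

lemma countable_free_Abelian_group:
  assumes "countable S" shows "countable (carrier (free_Abelian_group S))"
proof (rule countable_image_inj_on)
  let ?g = "\<lambda>c. (\<lambda>k. (k, Poly_Mapping.lookup c k)) ` Poly_Mapping.keys c :: ('a \<times> int) set"
  have "countable {Y. finite Y \<and> Y \<subseteq> S \<times> (UNIV :: int set)}"
    by (rule countable_Collect_finite_subset) (simp add: assms)
  moreover have "?g ` carrier (free_Abelian_group S) \<subseteq> {Y. finite Y \<and> Y \<subseteq> S \<times> UNIV}" by auto
  ultimately show "countable (?g ` carrier (free_Abelian_group S))" by (rule countable_subset[rotated])
  show "inj_on ?g (carrier (free_Abelian_group S))"
  proof (rule inj_onI, rule poly_mapping_eqI)
    fix c d :: "'a \<Rightarrow>\<^sub>0 int" and k assume eq: "?g c = ?g d"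
    have "(k, Poly_Mapping.lookup c k) \<in> ?g c \<longleftrightarrow> k \<in> Poly_Mapping.keys c"
      "(k, Poly_Mapping.lookup d k) \<in> ?g d \<longleftrightarrow> k \<in> Poly_Mapping.keys d"
      "(k, Poly_Mapping.lookup c k) \<in> ?g d \<longleftrightarrow> k \<in> Poly_Mapping.keys d \<and> Poly_Mapping.lookup c k = Poly_Mapping.lookup d k"
      "(k, Poly_Mapping.lookup d k) \<in> ?g c \<longleftrightarrow> k \<in> Poly_Mapping.keys c \<and> Poly_Mapping.lookup c k = Poly_Mapping.lookup d k"
      by auto
    then show "Poly_Mapping.lookup c k = Poly_Mapping.lookup d k"
      using eq by (metis in_keys_iff)
  qed
qed

text \<open>The map is built over the whole type and then restricted, so that one map serves all
  orbits and can be compared along morphisms.\<close>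

lemma augmentation_exists:
  "\<exists>a :: ('x \<Rightarrow>\<^sub>0 int) \<Rightarrow> int. (\<forall>S. a \<in> hom (free_Abelian_group S) integer_group) \<and> (\<forall>x. a (frag_of x) = 1)"
proof -
  obtain a :: "('x \<Rightarrow>\<^sub>0 int) \<Rightarrow> int"
    where a: "a \<in> hom (free_Abelian_group UNIV) integer_group" "\<And>x. x \<in> UNIV \<Longrightarrow> a (frag_of x) = 1"
    using comm_group.free_Abelian_group_universal[OF abelian_integer_group, of "\<lambda>x. 1" UNIV] by auto
  have "a \<in> hom (free_Abelian_group S) integer_group" for S
    using a(1) by (auto simp: hom_def)
  then show ?thesis using a(2) by blast
qed

context subgroup_family
begin

lemma left_module_points: "left_module G F points_module"
  unfolding left_module_def mval_points mact_points
proof (intro conjI ballI)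
  fix U V \<phi> assume "U \<in> orbit_objects G F" "V \<in> orbit_objects G F" "\<phi> \<in> orbit_hom G U V"
  then show "frag_extend (frag_of \<circ> \<phi>) \<in> hom (free_Abelian_group U) (free_Abelian_group V)"
    by (intro frag_extend_frag_of_hom) (auto simp: orbit_hom_def)
next
  fix U and c :: "'a set \<Rightarrow>\<^sub>0 int" assume c: "c \<in> carrier (free_Abelian_group U)"
  have "frag_extend (frag_of \<circ> (\<lambda>A\<in>U. A)) c = frag_extend frag_of c"
    by (rule frag_extend_eq) (use c in auto)
  then show "frag_extend (frag_of \<circ> (\<lambda>A\<in>U. A)) c = c" using frag_expansion[of c] by simp
next
  fix U V W \<phi> \<psi> and c :: "'a set \<Rightarrow>\<^sub>0 int" assume c: "c \<in> carrier (free_Abelian_group U)"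
  have "frag_extend (frag_of \<circ> compose U \<psi> \<phi>) c = frag_extend ((frag_of \<circ> \<psi>) \<circ> \<phi>) c"
    by (rule frag_extend_eq) (use c in \<open>auto simp: compose_def\<close>)
  then show "frag_extend (frag_of \<circ> compose U \<psi> \<phi>) c =
      frag_extend (frag_of \<circ> \<psi>) (frag_extend (frag_of \<circ> \<phi>) c)"
    by (simp add: frag_extend_compose)
qed (rule abelian_free_Abelian_group)

text \<open>The operator \<open>D\<close> of the overview. Because of the inverses, the coefficient
  of the result at \<open>B\<close> is the sum of the differences c(sB) - c(B), so the maximum
  principle gives closure under \<open>S\<close> itself.\<close>

definition translation_difference :: "'a set \<Rightarrow> ('a set \<Rightarrow>\<^sub>0 int) \<Rightarrow> 'a set \<Rightarrow>\<^sub>0 int" where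
  "translation_difference S = frag_extend (\<lambda>A. \<Sum>s\<in>S. frag_of (inv s <# A) - frag_of A)"

lemma translation_difference_hom:
  assumes U: "U \<in> orbit_objects G F" and S: "S \<subseteq> carrier G"
  shows "translation_difference S \<in> hom (free_Abelian_group U) (free_Abelian_group U)"
proof (rule homI)
  fix c :: "'a set \<Rightarrow>\<^sub>0 int" assume c: "c \<in> carrier (free_Abelian_group U)"
  have "(\<Sum>s\<in>S. frag_of (inv s <# A) - frag_of A) \<in> carrier (free_Abelian_group U)" if "A \<in> U" for A
  proof (rule sum_closed_free_Abelian_group)
    fix s assume "s \<in> S"
    then have "inv s <# A \<in> U" using orbit_translate[OF U _ that] S by blast
    then show "frag_of (inv s <# A) - frag_of A \<in> carrier (free_Abelian_group U)"
      using that keys_diff[of "frag_of (inv s <# A)" "frag_of A"] by auto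
  qed
  then have "(\<Union>A\<in>Poly_Mapping.keys c. Poly_Mapping.keys (\<Sum>s\<in>S. frag_of (inv s <# A) - frag_of A)) \<subseteq> U"
    using c by auto
  then show "translation_difference S c \<in> carrier (free_Abelian_group U)"
    using keys_frag_extend[of "\<lambda>A. \<Sum>s\<in>S. frag_of (inv s <# A) - frag_of A" c]
    by (simp add: translation_difference_def subset_trans)
qed (simp add: translation_difference_def frag_extend_add)

text \<open>Equivariance of \<open>\<phi>\<close> is commutation with left translations, so
  \<open>\<phi>\<close> commutes with every summand of the operator.\<close>

lemma translation_difference_natural:
  assumes S: "finite S" "S \<subseteq> carrier G" and \<phi>: "\<phi> \<in> orbit_hom G U V" and c: "Poly_Mapping.keys c \<subseteq> U"
  shows "translation_difference S (frag_extend (frag_of \<circ> \<phi>) c) =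
    frag_extend (frag_of \<circ> \<phi>) (translation_difference S c)"
  unfolding translation_difference_def frag_extend_frag_extend
proof (rule frag_extend_eq)
  fix A assume "A \<in> Poly_Mapping.keys c"
  then have A: "A \<in> U" using c by blast
  have "\<phi> (inv s <# A) = inv s <# \<phi> A" if "s \<in> S" for s
  proof -
    have "inv s \<in> carrier G" using that S by blast
    then show ?thesis using \<phi> A by (simp add: orbit_hom_def)
  qed
  then show "(frag_extend (\<lambda>A. \<Sum>s\<in>S. frag_of (inv s <# A) - frag_of A) \<circ> (frag_of \<circ> \<phi>)) A =
      (frag_extend (frag_of \<circ> \<phi>) \<circ> (\<lambda>A. \<Sum>s\<in>S. frag_of (inv s <# A) - frag_of A)) A"
    using S by (simp add: frag_extend_sum frag_extend_diff)
qed

text \<open>Both sides are additive in \<open>c\<close>, so basis elements suffice; for these the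
  point is that \<open>B = inv s <# A\<close> is equivalent to \<open>s <# B = A\<close>.\<close>

lemma lookup_translation_difference:
  assumes U: "U \<in> orbit_objects G F" and S: "S \<subseteq> carrier G"
    and c: "Poly_Mapping.keys c \<subseteq> U" and B: "B \<in> U"
  shows "Poly_Mapping.lookup (translation_difference S c) B =
    (\<Sum>s\<in>S. Poly_Mapping.lookup c (s <# B) - Poly_Mapping.lookup c B)"
  using c
proof (induction c rule: frag_induction)
  case (one A)
  have "B = inv s <# A \<longleftrightarrow> s <# B = A" if "s \<in> S" for s
  proof -
    have "s \<in> carrier G" "A \<subseteq> carrier G" "B \<subseteq> carrier G" using that S orbit_subset[OF U] one B by auto
    then show ?thesis by (auto simp: lcos_m_assoc lcos_mult_one)
  qed
  then show ?case
    by (simp add: translation_difference_def lookup_sum lookup_minus cong: sum.cong)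
next
  case (diff a b)
  then show ?case
    by (simp add: translation_difference_def frag_extend_diff lookup_minus algebra_simps flip: sum_subtractf)
qed (simp add: translation_difference_def)

text \<open>Maximum principle: where a finitely supported function killed by the difference operator
  attains its positive maximum, so it does at all translates by \<open>S\<close>.\<close>

lemma translation_difference_kernel:
  assumes U: "U \<in> orbit_objects G F" and S: "finite S" "S \<subseteq> carrier G"
    and c: "Poly_Mapping.keys c \<subseteq> U" "c \<noteq> 0" "translation_difference S c = 0"
  shows "\<exists>Z. finite Z \<and> Z \<noteq> {} \<and> Z \<subseteq> U \<and> (\<forall>s\<in>S. \<forall>A\<in>Z. s <# A \<in> Z)"
proof -
  have "\<exists>x. Poly_Mapping.lookup c x \<noteq> 0" using c(2) by (metis lookup_zero poly_mapping_eqI)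
  then obtain x where x: "Poly_Mapping.lookup c x \<noteq> 0" ..
  \<comment> \<open>The sign is chosen to obtain a positive value. A positive maximum over the
    support is a maximum over all points, and wherever that value is attained, the point lies in the
    support.\<close>
  define d where "d = (if Poly_Mapping.lookup c x > 0 then c else - c)"
  have d: "Poly_Mapping.keys d \<subseteq> U" "translation_difference S d = 0" "Poly_Mapping.lookup d x > 0"
    using c x by (auto simp: d_def translation_difference_def frag_extend_minus lookup_uminus)
  define m where "m = Max (Poly_Mapping.lookup d ` Poly_Mapping.keys d)"
  have xk: "x \<in> Poly_Mapping.keys d" using d(3) by (simp add: in_keys_iff)
  have le: "Poly_Mapping.lookup d y \<le> m" if "y \<in> Poly_Mapping.keys d" for y
    using that by (simp add: m_def)
  have m: "m > 0" using le[OF xk] d(3) by simp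
  have le': "Poly_Mapping.lookup d y \<le> m" for y
    using le[of y] m by (cases "y \<in> Poly_Mapping.keys d") (auto simp: in_keys_iff)
  define Z where "Z = {y \<in> Poly_Mapping.keys d. Poly_Mapping.lookup d y = m}"
  have "m \<in> Poly_Mapping.lookup d ` Poly_Mapping.keys d" unfolding m_def using xk by (intro Max_in) auto
  then have "Z \<noteq> {}" by (auto simp: Z_def)
  moreover have "s <# A \<in> Z" if s: "s \<in> S" and A: "A \<in> Z" for s A
  proof -
    have AU: "A \<in> U" using A d by (auto simp: Z_def)
    have "(\<Sum>s\<in>S. Poly_Mapping.lookup d (s <# A) - Poly_Mapping.lookup d A) = 0"
      using lookup_translation_difference[OF U S(2) d(1) AU] d(2) by simp
    \<comment> \<open>All terms are non-negative by maximality of \<open>m\<close>, so each of them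
      vanishes.\<close>
    then have "(\<Sum>s\<in>S. m - Poly_Mapping.lookup d (s <# A)) = 0"
      using A by (simp add: Z_def sum_subtractf)
    then have "m - Poly_Mapping.lookup d (s <# A) = 0"
      using sum_nonneg_eq_0_iff[OF S(1), of "\<lambda>s. m - Poly_Mapping.lookup d (s <# A)"] le' s by simp
    then show ?thesis using m by (simp add: Z_def in_keys_iff)
  qed
  moreover have "finite Z" "Z \<subseteq> U" using d by (auto simp: Z_def)
  ultimately show ?thesis by blast
qed

end

section \<open>Flatness of the constant module detects finite orbits\<close>

text \<open>If no orbit contained such a set, the operator would be injective on every orbit and,
  with its cokernel, would form a short exact sequence to which flatness applies. The trivial
  subgroup in \<open>F\<close> supplies the orbit G/1, on which the contradiction is found.\<close>

lemma (in subgroup_family) flat_imp_finite_invariant_set: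
  assumes flat: "flat_right_module TYPE('u) G F constant_Z_module"
    and inf: "infinite (UNIV :: 'u set)" and count: "countable (carrier G)"
    and one: "{\<one>} \<in> F" and S: "finite S" "S \<subseteq> carrier G"
  shows "\<exists>U\<in>orbit_objects G F. \<exists>Z. finite Z \<and> Z \<noteq> {} \<and> Z \<subseteq> U \<and> (\<forall>s\<in>S. \<forall>A\<in>Z. s <# A \<in> Z)"
proof (rule ccontr)
  assume no: "\<not> ?thesis"
  let ?D = "translation_difference S" and ?O = "orbit_objects G F"
  let ?A = "free_Abelian_group :: 'a set set \<Rightarrow> ('a set \<Rightarrow>\<^sub>0 int) monoid"
  have D_inj: "c = 0" if "U \<in> ?O" "Poly_Mapping.keys c \<subseteq> U" "?D c = 0" for U c
    using translation_difference_kernel[OF that(1) S that(2) _ that(3)] no that(1) by blast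
  have D_hom: "group_hom (?A U) (?A U) ?D" if "U \<in> ?O" for U
    using translation_difference_hom[OF that S(2)] by (simp add: group_hom_def group_hom_axioms_def)
  have D_closed: "Poly_Mapping.keys (?D c) \<subseteq> U" if "U \<in> ?O" "Poly_Mapping.keys c \<subseteq> U" for U c
    using hom_in_carrier[OF translation_difference_hom[OF that(1) S(2)], of c] that(2) by simp
  have D_zero: "?D 0 = 0" by (simp add: translation_difference_def)
  define K where "K U = ?D ` carrier (?A U)" for U
  have norm0: "{0} \<lhd> ?A U" for U
    using comm_group.subgroup_imp_normal[OF abelian_free_Abelian_group group.triv_subgroup[OF group_free_Abelian_group]]
    by simp
  have normK: "K U \<lhd> ?A U" if "U \<in> ?O" for U
    unfolding K_def by (rule comm_group.subgroup_imp_normal[OF abelian_free_Abelian_group group_hom.img_is_subgroup[OF D_hom[OF that]]])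
  have countU: "countable (carrier (?A U))" if U: "U \<in> ?O" for U
  proof (rule countable_free_Abelian_group)
    obtain H where "U = lcosets H" using U by (rule objE)
    then have "U = (\<lambda>a. a <# H) ` carrier G" by (auto simp: LCOSETS_def)
    then show "countable U" using count by simp
  qed
  \<comment> \<open>The encodings \<open>e U\<close> are injective and give a copy of the module of
    points; the encodings \<open>q U\<close> below have kernel \<open>K U\<close> and give a copy of
    the cokernel.\<close>
  have "\<forall>U\<in>?O. \<exists>e :: ('a set \<Rightarrow>\<^sub>0 int) \<Rightarrow> 'u. weak_group_morphism e {0} (?A U)"
    using exists_encoding[OF group_free_Abelian_group norm0 countU inf] by blast
  then obtain e :: "'a set set \<Rightarrow> ('a set \<Rightarrow>\<^sub>0 int) \<Rightarrow> 'u"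
    where e: "\<And>U. U \<in> ?O \<Longrightarrow> weak_group_morphism (e U) {0} (?A U)" by (metis bchoice)
  have "\<forall>U\<in>?O. \<exists>q :: ('a set \<Rightarrow>\<^sub>0 int) \<Rightarrow> 'u. weak_group_morphism q (K U) (?A U)"
    using exists_encoding[OF group_free_Abelian_group normK countU inf] by blast
  then obtain q :: "'a set set \<Rightarrow> ('a set \<Rightarrow>\<^sub>0 int) \<Rightarrow> 'u"
    where q: "\<And>U. U \<in> ?O \<Longrightarrow> weak_group_morphism (q U) (K U) (?A U)" by (metis bchoice)
  have act_closed: "Poly_Mapping.keys (frag_extend (frag_of \<circ> \<phi>) c) \<subseteq> V"
    if "\<phi> \<in> orbit_hom G U V" "Poly_Mapping.keys c \<subseteq> U" for U V \<phi> and c :: "'a set \<Rightarrow>\<^sub>0 int"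
    using hom_in_carrier[OF frag_extend_frag_of_hom[of \<phi> U V], of c] that by (auto simp: orbit_hom_def)
  interpret P: module_encoding G F points_module "\<lambda>U. {0}" e
    by (intro module_encoding.intro module_encoding_axioms.intro subgroup_family_axioms)
      (use left_module_points e in auto)
  interpret Q: module_encoding G F points_module K q
  proof (intro module_encoding.intro module_encoding_axioms.intro subgroup_family_axioms)
    fix U V \<phi> assume "U \<in> ?O" "V \<in> ?O" and \<phi>: "\<phi> \<in> orbit_hom G U V"
    show "mact points_module U V \<phi> ` K U \<subseteq> K V"
    proof (rule image_subsetI)
      fix y assume "y \<in> K U"
      then obtain c where c: "y = ?D c" "Poly_Mapping.keys c \<subseteq> U" by (auto simp: K_def)
      have "mact points_module U V \<phi> y = ?D (frag_extend (frag_of \<circ> \<phi>) c)"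
        using translation_difference_natural[OF S \<phi> c(2)] c(1) by simp
      then show "mact points_module U V \<phi> y \<in> K V"
        unfolding K_def using act_closed[OF \<phi> c(2)] by simp
    qed
  qed (use left_module_points q in auto)
  let ?P = "image_module e points_module" and ?Q = "image_module q points_module"
  \<comment> \<open>Through the encodings, \<open>\<eta>\<close> is the operator and
    \<open>\<theta>\<close> the projection onto its cokernel; the identity induces the latter
    because only the kernels differ.\<close>
  define \<eta> where "\<eta> U = induced_map (e U) (e U) (carrier (?A U)) ?D" for U
  define \<theta> where "\<theta> U = induced_map (e U) (q U) (carrier (?A U)) id" for U
  have \<eta>_e: "\<eta> U (e U c) = e U (?D c)" if "U \<in> ?O" "Poly_Mapping.keys c \<subseteq> U" for U c
    unfolding \<eta>_def
    by (rule induced_map_eq[OF group_free_Abelian_group e group_free_Abelian_group e translation_difference_hom])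
      (use that S D_zero in auto)
  have zeroK: "0 \<in> K U" for U unfolding K_def by (rule image_eqI[of _ _ 0]) (simp_all add: D_zero)
  have \<theta>_e: "\<theta> U (e U c) = q U c" if "U \<in> ?O" "Poly_Mapping.keys c \<subseteq> U" for U c
    unfolding \<theta>_def
    by (subst induced_map_eq[OF group_free_Abelian_group e group_free_Abelian_group q])
      (use that zeroK in \<open>auto intro: homI\<close>)
  have \<eta>_hom: "\<eta> U \<in> hom (mval ?P U) (mval ?P U)" if "U \<in> ?O" for U
    unfolding \<eta>_def P.mval_image mval_points
    by (rule induced_map_hom[OF group_free_Abelian_group e group_free_Abelian_group e translation_difference_hom])
      (use that S D_zero in auto)
  have \<theta>_hom: "\<theta> U \<in> hom (mval ?P U) (mval ?Q U)" if "U \<in> ?O" for U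
    unfolding \<theta>_def P.mval_image Q.mval_image mval_points
    by (rule induced_map_hom[OF group_free_Abelian_group e group_free_Abelian_group q])
      (use that zeroK in \<open>auto intro: homI\<close>)
  have elemP: "\<exists>c. Poly_Mapping.keys c \<subseteq> U \<and> y = e U c" if "y \<in> carrier (mval ?P U)" for U y
    using that by (simp only: P.mval_image mval_points image_group_carrier image_iff carrier_free_Abelian_group_iff Bex_def)
  have e_closed: "e U c \<in> carrier (mval ?P U)" if "Poly_Mapping.keys c \<subseteq> U" for U c
    using that by (auto simp: image_group_carrier)
  have e_one: "e U c = \<one>\<^bsub>mval ?P U\<^esub> \<longleftrightarrow> c = 0" if "U \<in> ?O" "Poly_Mapping.keys c \<subseteq> U" for U c
    using weak_group_morphism_eq_one_iff[OF group_free_Abelian_group e[OF that(1)], of c] that(2) by simp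
  have q_one: "q U c = \<one>\<^bsub>mval ?Q U\<^esub> \<longleftrightarrow> c \<in> K U" if "U \<in> ?O" "Poly_Mapping.keys c \<subseteq> U" for U c
    using weak_group_morphism_eq_one_iff[OF group_free_Abelian_group q[OF that(1)], of c] that(2) by simp
  have grpP: "Group.group (mval ?P U)" and grpQ: "Group.group (mval ?Q U)" if "U \<in> ?O" for U
    using P.comm_group_image[OF that] Q.comm_group_image[OF that] by (auto simp: comm_group.axioms(2))
  have lm: "left_module G F ?P" "left_module G F ?Q" by (rule P.left_module_image Q.left_module_image)+
  have \<eta>: "\<eta> \<in> left_module_hom G F ?P ?P"
    unfolding left_module_hom_def
  proof (intro CollectI conjI ballI \<eta>_hom)
    fix U V \<phi> y assume a: "U \<in> ?O" "V \<in> ?O" "\<phi> \<in> orbit_hom G U V" "y \<in> carrier (mval ?P U)"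
    then obtain c where c: "Poly_Mapping.keys c \<subseteq> U" "y = e U c" using elemP by blast
    then show "\<eta> V (mact ?P U V \<phi> y) = mact ?P U V \<phi> (\<eta> U y)"
      using a P.mact_image[OF a(1-3)] translation_difference_natural[OF S a(3) c(1)]
      by (simp add: \<eta>_e act_closed[OF a(3)] D_closed)
  qed
  have \<theta>: "\<theta> \<in> left_module_hom G F ?P ?Q"
    unfolding left_module_hom_def
  proof (intro CollectI conjI ballI \<theta>_hom)
    fix U V \<phi> y assume a: "U \<in> ?O" "V \<in> ?O" "\<phi> \<in> orbit_hom G U V" "y \<in> carrier (mval ?P U)"
    then obtain c where c: "Poly_Mapping.keys c \<subseteq> U" "y = e U c" using elemP by blast
    then show "\<theta> V (mact ?P U V \<phi> y) = mact ?Q U V \<phi> (\<theta> U y)"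
      using a P.mact_image[OF a(1-3)] Q.mact_image[OF a(1-3)]
      by (simp add: \<theta>_e act_closed[OF a(3)])
  qed
  have ses: "short_exact_sequence (mval ?Q U) (mval ?P U) (mval ?P U) (\<theta> U) (\<eta> U)" if U: "U \<in> ?O" for U
  proof -
    have "y = \<one>\<^bsub>mval ?P U\<^esub>" if y: "y \<in> carrier (mval ?P U)" "\<eta> U y = \<one>\<^bsub>mval ?P U\<^esub>" for y
    proof -
      obtain c where c: "Poly_Mapping.keys c \<subseteq> U" "y = e U c" using elemP[OF y(1)] by blast
      then have "?D c = 0" using y(2) \<eta>_e[OF U c(1)] e_one[OF U D_closed[OF U c(1)]] by simp
      then show ?thesis using D_inj[OF U c(1)] c e_one[OF U c(1)] by blast
    qed
    then have mon: "\<eta> U \<in> mon (mval ?P U) (mval ?P U)"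
      using \<eta>_hom[OF U] by (simp add: mon_iff_hom_one grpP[OF U] del: P.mval_image)
    have "carrier (mval ?Q U) \<subseteq> \<theta> U ` carrier (mval ?P U)"
    proof
      fix z assume "z \<in> carrier (mval ?Q U)"
      then obtain c where "Poly_Mapping.keys c \<subseteq> U" "z = q U c" by (auto simp: image_group_carrier)
      then show "z \<in> \<theta> U ` carrier (mval ?P U)" using \<theta>_e[OF U] e_closed by (metis imageI)
    qed
    then have epi: "\<theta> U \<in> epi (mval ?P U) (mval ?Q U)" using \<theta>_hom[OF U] by (simp add: epi_iff_subset)
    have ker: "y \<in> kernel (mval ?P U) (mval ?Q U) (\<theta> U) \<longleftrightarrow> y \<in> \<eta> U ` carrier (mval ?P U)" for y
    proof
      assume "y \<in> kernel (mval ?P U) (mval ?Q U) (\<theta> U)"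
      then have y: "y \<in> carrier (mval ?P U)" "\<theta> U y = \<one>\<^bsub>mval ?Q U\<^esub>" by (simp_all add: kernel_def)
      obtain c where c: "Poly_Mapping.keys c \<subseteq> U" "y = e U c" using elemP[OF y(1)] by blast
      then have "c \<in> K U" using y(2) \<theta>_e[OF U c(1)] q_one[OF U c(1)] by simp
      then obtain b where "Poly_Mapping.keys b \<subseteq> U" "c = ?D b" by (auto simp: K_def)
      then show "y \<in> \<eta> U ` carrier (mval ?P U)" using \<eta>_e[OF U] c(2) e_closed by (metis imageI)
    next
      assume "y \<in> \<eta> U ` carrier (mval ?P U)"
      then obtain z where z: "z \<in> carrier (mval ?P U)" "y = \<eta> U z" by blast
      obtain c where c: "Poly_Mapping.keys c \<subseteq> U" "z = e U c" using elemP[OF z(1)] by blast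
      have "?D c \<in> K U" using c(1) by (auto simp: K_def)
      then have "\<theta> U y = \<one>\<^bsub>mval ?Q U\<^esub>"
        using z(2) c \<eta>_e[OF U c(1)] \<theta>_e[OF U D_closed[OF U c(1)]] q_one[OF U D_closed[OF U c(1)]] by simp
      moreover have "y \<in> carrier (mval ?P U)" using z hom_in_carrier[OF \<eta>_hom[OF U]] by blast
      ultimately show "y \<in> kernel (mval ?P U) (mval ?Q U) (\<theta> U)" by (simp add: kernel_def)
    qed
    then have "kernel (mval ?P U) (mval ?Q U) (\<theta> U) = \<eta> U ` carrier (mval ?P U)" by blast
    then show ?thesis
      using mon epi \<eta>_hom[OF U] \<theta>_hom[OF U] grpP[OF U] grpQ[OF U]
      by (simp add: short_exact_sequence_iff group_hom_def group_hom_axioms_def del: P.mval_image Q.mval_image)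
  qed
  have "module_short_exact G F ?P ?P ?Q \<eta> \<theta>"
    using lm \<eta> \<theta> ses by (simp add: module_short_exact_def del: P.mval_image Q.mval_image)
  then have ses_T: "short_exact_sequence (module_tensor G F constant_Z_module ?Q)
      (module_tensor G F constant_Z_module ?P) (module_tensor G F constant_Z_module ?P)
      (module_tensor_map G F constant_Z_module ?Q \<theta>) (module_tensor_map G F constant_Z_module ?P \<eta>)"
    using flat unfolding flat_right_module_def by blast
  interpret T: constant_tensor G F ?P by unfold_locales (rule lm(1))
  let ?T = "module_tensor G F constant_Z_module ?P"
  define U0 where "U0 = lcosets {\<one>}"
  have U0: "U0 \<in> ?O" using objI[OF one] by (simp add: U0_def)
  have sing: "a <# {\<one>} = {a}" if "a \<in> carrier G" for a using that by (simp add: l_coset_def)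
  have ptU0: "{a} \<in> U0" if "a \<in> carrier G" for a
    using lcosetsI[OF that, of "{\<one>}"] sing[OF that] by (simp add: U0_def)
  define w where "w c = T.unit_class U0 (e U0 c)" for c
  have w_hom: "w \<in> hom (?A U0) ?T"
    using Group.hom_compose[OF P.e_hom[OF U0] T.unit_class_hom[OF U0, unfolded P.mval_image]]
    by (simp add: w_def[abs_def] comp_def)
  interpret w: group_hom "?A U0" ?T w
    using w_hom by (simp add: group_hom_def group_hom_axioms_def T.T.is_group)
  have w_point: "w (frag_of {a}) = w (frag_of {\<one>})" if a: "a \<in> carrier G" for a
  proof -
    \<comment> \<open>Right multiplication preserves G/1 because its cosets are singletons; it moves
      the point {1} to {a}.\<close>
    let ?\<phi> = "\<lambda>A\<in>U0. A #> a"
    have \<phi>_pt: "{b} #> a = {b \<otimes> a}" for b by (simp add: r_coset_def)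
    have \<phi>_hom: "?\<phi> \<in> orbit_hom G U0 U0"
    proof -
      have "A #> a \<in> U0" if "A \<in> U0" for A
        using that a ptU0 unfolding U0_def by (auto elim!: lcosetsE simp: sing \<phi>_pt)
      moreover have "(g <# A) #> a = g <# (A #> a)" if "g \<in> carrier G" "A \<in> U0" for g A
        using coset_assoc[OF that(1) a orbit_subset[OF U0 that(2)]] by simp
      ultimately show ?thesis using orbit_translate[OF U0] by (auto simp: orbit_hom_def)
    qed
    have "mact ?P U0 U0 ?\<phi> (e U0 (frag_of {\<one>})) = e U0 (frag_of {a})"
      using P.mact_image[OF U0 U0 \<phi>_hom, of "frag_of {\<one>}"] a ptU0 by (simp add: \<phi>_pt)
    then show ?thesis
      using T.unit_class_act[OF U0 U0 \<phi>_hom e_closed, of "frag_of {\<one>}"] ptU0 by (simp add: w_def)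
  qed
  have pt_keys: "Poly_Mapping.keys (frag_of {\<one>}) \<subseteq> U0" using ptU0 by simp
  \<comment> \<open>The sum is additive while the target of \<open>w\<close> is multiplicative, so
    the summands are treated one by one. Membership is carried along because \<open>w\<close> is
    multiplicative only on the carrier.\<close>
  have "w (\<Sum>s\<in>R. frag_of (inv s <# {\<one>}) - frag_of {\<one>}) = \<one>\<^bsub>?T\<^esub> \<and>
      (\<Sum>s\<in>R. frag_of (inv s <# {\<one>}) - frag_of {\<one>}) \<in> carrier (?A U0)" if "finite R" "R \<subseteq> S" for R
    using that
  proof (induction R rule: finite_induct)
    case empty
    then show ?case using w.hom_one by simp
  next
    case (insert s R)
    have s: "s \<in> carrier G" "inv s \<in> carrier G" using insert.prems S by auto
    let ?x = "frag_of {inv s} - frag_of {\<one>} :: 'a set \<Rightarrow>\<^sub>0 int" and ?y = "\<Sum>s\<in>R. frag_of (inv s <# {\<one>}) - frag_of {\<one>}"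
    have pts: "frag_of {inv s} \<in> carrier (?A U0)" "frag_of {\<one>} \<in> carrier (?A U0)" using s ptU0 by auto
    have x: "?x = frag_of {inv s} \<otimes>\<^bsub>?A U0\<^esub> inv\<^bsub>?A U0\<^esub> frag_of {\<one>}" using pts(2) by simp
    have xc: "?x \<in> carrier (?A U0)" unfolding x by (intro w.G.m_closed w.G.inv_closed pts)
    have "w ?x = w (frag_of {inv s}) \<otimes>\<^bsub>?T\<^esub> inv\<^bsub>?T\<^esub> w (frag_of {\<one>})"
      unfolding x using pts by (simp only: w.hom_mult w.hom_inv w.G.inv_closed)
    then have wx: "w ?x = \<one>\<^bsub>?T\<^esub>" using w_point[OF s(2)] w.hom_closed[OF pts(2)] by simp
    have IH: "w ?y = \<one>\<^bsub>?T\<^esub>" "?y \<in> carrier (?A U0)" using insert by auto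
    have "w (?x + ?y) = \<one>\<^bsub>?T\<^esub>" using w.hom_mult[OF xc IH(2)] wx IH(1) by simp
    moreover have "?x + ?y \<in> carrier (?A U0)" using w.G.m_closed[OF xc IH(2)] by simp
    ultimately show ?case using insert.hyps s sing by simp
  qed
  then have "w (?D (frag_of {\<one>})) = \<one>\<^bsub>?T\<^esub>" using S(1) by (simp add: translation_difference_def)
  then have "T.unit_class U0 (\<eta> U0 (e U0 (frag_of {\<one>}))) = \<one>\<^bsub>?T\<^esub>"
    using \<eta>_e[OF U0 pt_keys] by (simp add: w_def)
  then have "module_tensor_map G F constant_Z_module ?P \<eta> (w (frag_of {\<one>})) = \<one>\<^bsub>?T\<^esub>"
    using constant_tensor_map[OF lm(1) lm(1) \<eta> U0 e_closed[OF pt_keys]] by (simp add: w_def)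
  moreover have "module_tensor_map G F constant_Z_module ?P \<eta> \<in> mon ?T ?T"
    using short_exact_sequenceD[OF ses_T] by blast
  moreover have "w (frag_of {\<one>}) \<in> carrier ?T" using w.hom_closed[of "frag_of {\<one>}"] pt_keys by simp
  \<comment> \<open>The induced map takes the class of the point to the class of its image under the
    operator, which is trivial. Injectivity, provided by flatness, makes the class of the point
    trivial.\<close>
  ultimately have w1: "w (frag_of {\<one>}) = \<one>\<^bsub>?T\<^esub>"
    using mon_iff_hom_one[OF T.T.is_group T.T.is_group] by blast
  obtain a :: "('a set \<Rightarrow>\<^sub>0 int) \<Rightarrow> int"
    where a: "\<And>U. a \<in> hom (?A U) integer_group" "\<And>x. a (frag_of x) = 1"
    using augmentation_exists by blast
  \<comment> \<open>Morphisms take points to points, and each point has augmentation 1.\<close>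
  have a_act: "a (frag_extend (frag_of \<circ> \<phi>) c) = a c" for \<phi> and c :: "'a set \<Rightarrow>\<^sub>0 int"
  proof -
    interpret a: group_hom "?A UNIV" integer_group a using a by (simp add: group_hom_def group_hom_axioms_def)
    have minus: "a (b - c) = a b - a c" for b c
      using a.hom_mult[of b "- c"] a.hom_inv[of c] by simp
    have "a 0 = 0" using a.hom_one by simp
    with subset_UNIV show ?thesis
      by (induction c rule: frag_induction) (simp_all add: a(2) frag_extend_diff minus)
  qed
  \<comment> \<open>Decoding followed by augmentation. This is a cocone into the integers, so it
    induces a homomorphism on the tensor product with value 1 on the class of the point.\<close>
  define h where "h U = a \<circ> inv_into (carrier (?A U)) (e U)" for U
  have h_e: "h U (e U c) = a c" if U: "U \<in> ?O" and c: "Poly_Mapping.keys c \<subseteq> U" for U c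
  proof -
    have "inj_on (e U) (carrier (?A U))"
      using weak_group_morphism.inj_mod_subgroup[OF e[OF U]] by (auto intro!: inj_onI)
    then show ?thesis using c by (simp add: h_def inv_into_f_f)
  qed
  have h_hom: "h U \<in> hom (mval ?P U) integer_group" if U: "U \<in> ?O" for U
  proof (rule homI)
    fix y z assume "y \<in> carrier (mval ?P U)" "z \<in> carrier (mval ?P U)"
    then obtain b c where bc: "Poly_Mapping.keys b \<subseteq> U" "y = e U b" "Poly_Mapping.keys c \<subseteq> U" "z = e U c"
      using elemP by meson
    have k: "Poly_Mapping.keys (b + c) \<subseteq> U" using bc keys_add[of b c] by blast
    have "y \<otimes>\<^bsub>mval ?P U\<^esub> z = e U (b + c)" using hom_mult[OF P.e_hom[OF U], of b c] bc by simp
    then show "h U (y \<otimes>\<^bsub>mval ?P U\<^esub> z) = h U y \<otimes>\<^bsub>integer_group\<^esub> h U z"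
      using h_e[OF U] bc k hom_mult[OF a(1)[of U], of b c] by simp
  qed simp
  have h_act: "h V (mact ?P U V \<phi> y) = h U y"
    if o: "U \<in> ?O" "V \<in> ?O" "\<phi> \<in> orbit_hom G U V" "y \<in> carrier (mval ?P U)" for U V \<phi> y
  proof -
    obtain c where c: "Poly_Mapping.keys c \<subseteq> U" "y = e U c" using elemP[OF o(4)] by blast
    then show ?thesis
      using P.mact_image[OF o(1-3)] h_e[OF o(2) act_closed[OF o(3) c(1)]] h_e[OF o(1) c(1)] a_act by simp
  qed
  obtain k where k: "k \<in> hom ?T integer_group"
    "\<And>U n. \<lbrakk>U \<in> ?O; n \<in> carrier (mval ?P U)\<rbrakk> \<Longrightarrow> k (T.unit_class U n) = h U n"
    by (rule T.constant_tensor_universal[OF abelian_integer_group h_hom h_act]) blast+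
  have "k (w (frag_of {\<one>})) = 1"
    using k(2)[OF U0 e_closed[OF pt_keys]] h_e[OF U0 pt_keys] a(2) by (simp add: w_def)
  moreover have "k \<one>\<^bsub>?T\<^esub> = 0" using hom_one[OF k(1) T.T.is_group] by simp
  ultimately show False using w1 by simp
qed

theorem corollary2:
  fixes G :: "('a, 'b) monoid_scheme"
  assumes "group G"
    and "countable (carrier G)"
    and "infinite (UNIV :: 'u set)"
  shows "locally_virtually_cyclic G \<longleftrightarrow>
    flat_right_module TYPE('u) G (virtually_cyclic_subgroups G) constant_Z_module"
proof
  interpret group G by fact
  assume "locally_virtually_cyclic G"
  then interpret directed_family G "virtually_cyclic_subgroups G" by (rule locally_virtually_cyclic_directed)
  show "flat_right_module TYPE('u) G (virtually_cyclic_subgroups G) constant_Z_module"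
    by (rule flat_constant_Z)
next
  interpret group G by fact
  interpret subgroup_family G "virtually_cyclic_subgroups G"
    by (intro subgroup_family.intro subgroup_family_axioms.intro is_group)
      (simp add: virtually_cyclic_subgroups_def)
  assume flat: "flat_right_module TYPE('u) G (virtually_cyclic_subgroups G) constant_Z_module"
  show "locally_virtually_cyclic G"
    unfolding locally_virtually_cyclic_def
  proof (intro allI impI, elim conjE)
    fix S assume S: "finite S" "S \<subseteq> carrier G"
    obtain K Z where K: "K \<in> virtually_cyclic_subgroups G"
      and Z: "finite Z" "Z \<noteq> {}" "Z \<subseteq> lcosets\<^bsub>G\<^esub> K" "\<forall>s\<in>S. \<forall>A\<in>Z. s <#\<^bsub>G\<^esub> A \<in> Z"
      using flat_imp_finite_invariant_set[OF flat assms(3,2) trivial_virtually_cyclic S]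
      by (auto elim!: objE)
    have "generate G S \<in> virtually_cyclic_subgroups G"
      by (rule virtually_cyclic_if_finite_closed[OF K S(2) Z(1-3)]) (use Z(4) in blast)
    then show "virtually_cyclic_group (subgroup_generated G S)"
      using subgroup_generated_virtually_cyclic_iff[OF S(2)] by blast
  qed
qed

end
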